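(* Let $E\subset\mathbb{R}^d$ be a non-empty compact set, $\theta\in(0,1]$, $m$ an integer with $0<m\le d$, $0<\alpha<1$, and let $B_\alpha:\mathbb{R}^d\to\mathbb{R}^m$ be index-$\alpha$ fractional Brownian motion. Then $$\underline{\dim}_\theta B_\alpha(E)=m\ \text{ almost surely}\iff\alpha m\le\underline{\dim}_{qH}E,$$ and $$\overline{\dim}_\theta B_\alpha(E)=m\ \text{ almost surely}\iff\alpha m\le\overline{\dim}_{qH}E.$$
   Context: Fractional Brownian motion. For $0<\alpha<1$, index-$\alpha$ fractional Brownian motion $B_\alpha=(B_{\alpha,1},\dots,B_{\alpha,m}):\mathbb{R}^d\to\mathbb{R}^m$ is the random function whose components $B_{\alpha,i}:\mathbb{R}^d\to\mathbb{R}$ satisfy: $B_{\alpha,i}(0)=0$; $B_{\alpha,i}$ is continuous with probability $1$; the increments $B_{\alpha,i}(x)-B_{\alpha,i}(y)$ are normally distributed with mean $0$ and variance $|x-y|^{2\alpha}$ for all $x,y\in\mathbb{R}^d$; and $B_{\alpha,i}$, $B_{\alpha,j}$ are independent for $i\ne j$. Intermediate dimensions. $|U|$ denotes the diameter of a set $U$. For a non-empty bounded set $F$ in a Euclidean space and $\theta\in(0,1]$, the lower $\theta$-intermediate dimension $\underline{\dim}_\theta F$ is the infimum of all $s\ge 0$ such that for all $\epsilon>0$ and all $\delta_0>0$ there exist $0<\delta\le\delta_0$ and a cover $\{U_i\}_{i\in I}$ of $F$ with $\delta^{1/\theta}\le|U_i|\le\delta$ for all $i$ and $\sum_{i}|U_i|^s\le\epsilon$.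 The upper $\theta$-intermediate dimension $\overline{\dim}_\theta F$ is the infimum of all $s\ge 0$ such that for all $\epsilon>0$ there exists $\delta_0>0$ such that for all $0<\delta\le\delta_0$ there is a cover $\{U_i\}_{i\in I}$ of $F$ with $\delta^{1/\theta}\le|U_i|\le\delta$ for all $i$ and $\sum_i|U_i|^s\le\epsilon$. Quasi-Hausdorff dimensions. $\underline{\dim}_{qH}F:=\lim_{\theta\to0^+}\underline{\dim}_\theta F$ and $\overline{\dim}_{qH}F:=\lim_{\theta\to0^+}\overline{\dim}_\theta F$. *)

theory Defs
  imports "HOL-Probability.Probability"
begin

text \<open>
  A cover is a set of sets, of arbitrary cardinality. Boundedness is required because the
  library's \<open>diameter\<close> is unspecified on unbounded sets. The lower bound on the diameters is
  positive, so summability forces the cover to be finite.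
\<close>

definition admissible_cover ::
    "real \<Rightarrow> real \<Rightarrow> real \<Rightarrow> real \<Rightarrow> 'a::euclidean_space set \<Rightarrow> 'a set set \<Rightarrow> bool" where
  "admissible_cover \<theta> s \<epsilon> \<delta> F C \<longleftrightarrow>
     F \<subseteq> \<Union>C \<and>
     (\<forall>U\<in>C. bounded U \<and> \<delta> powr (1 / \<theta>) \<le> diameter U \<and> diameter U \<le> \<delta>) \<and>
     (\<lambda>U. diameter U powr s) summable_on C \<and>
     (\<Sum>\<^sub>\<infinity>U\<in>C. diameter U powr s) \<le> \<epsilon>"

definition lower_intermediate_dim :: "real \<Rightarrow> 'a::euclidean_space set \<Rightarrow> real" where
  "lower_intermediate_dim \<theta> F =
     Inf {s. s \<ge> 0 \<and>
       (\<forall>\<epsilon>>0. \<forall>\<delta>0>0. \<exists>\<delta>. 0 < \<delta> \<and> \<delta> \<le> \<delta>0 \<and> (\<exists>C. admissible_cover \<theta> s \<epsilon> \<delta> F C))}"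

definition upper_intermediate_dim :: "real \<Rightarrow> 'a::euclidean_space set \<Rightarrow> real" where
  "upper_intermediate_dim \<theta> F =
     Inf {s. s \<ge> 0 \<and>
       (\<forall>\<epsilon>>0. \<exists>\<delta>0>0. \<forall>\<delta>. 0 < \<delta> \<and> \<delta> \<le> \<delta>0 \<longrightarrow> (\<exists>C. admissible_cover \<theta> s \<epsilon> \<delta> F C))}"

text \<open>
  For non-empty bounded sets the intermediate dimensions are nondecreasing in \<open>\<theta>\<close> and
  lie between 0 and the dimension of the space, so the following limits exist.
\<close>

definition lower_quasi_Hausdorff_dim :: "'a::euclidean_space set \<Rightarrow> real" where
  "lower_quasi_Hausdorff_dim F = Lim (at_right 0) (\<lambda>\<theta>. lower_intermediate_dim \<theta> F)"

definition upper_quasi_Hausdorff_dim :: "'a::euclidean_space set \<Rightarrow> real" where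
  "upper_quasi_Hausdorff_dim F = Lim (at_right 0) (\<lambda>\<theta>. upper_intermediate_dim \<theta> F)"

text \<open>
  The second argument of \<open>normal_density\<close> is the standard deviation, so the increments have
  variance \<open>norm (x - y) powr (2 * \<alpha>)\<close>; for \<open>x = y\<close> the increment is 0. The components are
  independent as random functions, i.e. as random elements of the product space of all
  functions from \<open>real ^ 'd\<close> to \<open>real\<close>, and they form an independent family, not merely a
  pairwise independent one.
\<close>

locale fractional_Brownian_motion = prob_space M for M :: "'w measure" +
  fixes \<alpha> :: real
    and B :: "'w \<Rightarrow> real ^ 'd \<Rightarrow> real ^ 'm"
  assumes zero: "\<And>i \<omega>. \<omega> \<in> space M \<Longrightarrow> B \<omega> 0 $ i = 0"
    and continuous: "\<And>i. AE \<omega> in M. continuous_on UNIV (\<lambda>x. B \<omega> x $ i)"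
    and increments: "\<And>i x y. x \<noteq> y \<Longrightarrow>
      distributed M lborel (\<lambda>\<omega>. B \<omega> x $ i - B \<omega> y $ i)
        (normal_density 0 (norm (x - y) powr \<alpha>))"
    and independent:
      "indep_vars (\<lambda>_. Pi\<^sub>M UNIV (\<lambda>_. borel)) (\<lambda>i \<omega> x. B \<omega> x $ i) UNIV"

end

theory Submission
  imports Defs
begin

text \<open>
  Let \<open>N\<^sub>k F\<close> be the number of cubes of the mesh of side \<open>2\<^sup>-\<^sup>k\<close> that meet \<open>F\<close>.

  Full dimension does not depend on \<open>\<theta>\<close>. If a set \<open>F\<close> in dimension \<open>m\<close> has a cover with
  diameters between \<open>\<delta> powr (1/\<theta>)\<close> and \<open>\<delta>\<close> and with \<open>\<Sum>|U|\<^sup>s \<le> 1\<close> for some \<open>s < m\<close>, then chopping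
  every member into cubes of side about \<open>\<delta> powr (1/\<theta>)\<close> costs \<open>\<Sum>(2\<^sup>k|U|)\<^sup>m \<le> 2\<^sup>k\<^sup>m \<delta> powr (m - s)\<close>
  cubes, and \<open>\<delta> powr (m - s)\<close> is a negative power of \<open>2\<^sup>k\<close>. So \<open>F\<close> has \<open>\<theta>\<close>-dimension less than \<open>m\<close>
  exactly when \<open>N\<^sub>k F\<close> is at most a constant times \<open>2 powr (k t)\<close> for some \<open>t < m\<close>, for infinitely
  many \<open>k\<close> (lower dimension) or for all large \<open>k\<close> (upper dimension), and \<open>\<theta>\<close> has disappeared.
  It remains to compare \<open>N\<^sub>k (B\<^sub>\<alpha>(E))\<close> with the covers of \<open>E\<close>.

  If \<open>\<alpha> m\<close> exceeds the quasi-Hausdorff dimension, then some exponent \<open>s < \<alpha> m\<close> works for \<open>E\<close> at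
  some \<open>\<theta>'\<close>. Choose \<open>\<gamma> < \<alpha>\<close> with \<open>s < \<gamma> m\<close>. Paths are locally \<open>\<gamma>\<close>-Hoelder almost surely
  (\<open>AE_locally_Holder\<close>), and the same chopping, applied to the images of the members of a cover of
  \<open>E\<close>, bounds \<open>N\<^sub>k (B\<^sub>\<alpha>(E))\<close> (\<open>cell_count_of_Holder_image\<close>). The image has dimension less than \<open>m\<close>.

  Conversely suppose that \<open>\<alpha> m\<close> is at most the quasi-Hausdorff dimension and let \<open>t < t' < m\<close>. Then
  \<open>\<alpha> t'\<close> is not an exponent of \<open>E\<close>, even for a very small \<open>\<theta>'\<close>. At a scale \<open>\<delta>\<close> without a good
  cover a finite form of Frostman's lemma (\<open>Frostman_weights\<close>) gives weights \<open>w\<close> on finitely many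
  points of \<open>E\<close>, of total mass \<open>W\<close> bounded below, with mass at most a constant times \<open>r powr (\<alpha> t')\<close>
  in each ball of radius \<open>r\<close> for \<open>r\<close> between \<open>\<rho> = \<delta> powr (1/\<theta>')\<close> and \<open>\<delta>\<close>, up to constants.
  Two points at distance \<open>r\<close> have images in the same cube of side about \<open>\<rho> powr \<alpha>\<close> with probability
  at most about \<open>(\<rho>/r) powr (\<alpha> m)\<close>, so the expected mass \<open>V\<close> of the pairs whose images share a cube
  is at most a constant times \<open>W\<^sup>2 (\<rho> powr \<alpha>) powr t'\<close>; the contribution of the pairs at distance
  beyond \<open>\<delta>\<close>, about which the weights say nothing, is at most a constant times
  \<open>(\<rho>/\<delta>) powr (\<alpha> m) W\<^sup>2\<close>, and is harmless because \<open>\<theta>'\<close> is small.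
  Cauchy-Schwarz gives \<open>W\<^sup>2 \<le> N\<^sub>k (B\<^sub>\<alpha>(E)) V\<close>, and Markov's inequality with the Borel-Cantelli lemma turns this into \<open>N\<^sub>k (B\<^sub>\<alpha>(E)) > 2 powr (k t)\<close>, almost surely
  for all large \<open>k\<close> that correspond to such a scale.

  The lower and the upper dimension differ only in whether a cover is required at arbitrarily small
  scales or at all small scales. The locale \<open>scale_quantifier\<close> abstracts from this choice, so that
  each argument is given once.
\<close>

section \<open>Cells of a cubical mesh\<close>

definition cell :: "real \<Rightarrow> real ^ 'n \<Rightarrow> 'n \<Rightarrow> int" where
  "cell h x = (\<lambda>i. \<lfloor>x $ i / h\<rfloor>)"

lemma cell_eq_component_dist:
  assumes "h > 0" "cell h x = cell h y"
  shows "\<bar>x $ i - y $ i\<bar> < h"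
proof -
  have "\<lfloor>x $ i / h\<rfloor> = \<lfloor>y $ i / h\<rfloor>"
    using assms(2) by (metis cell_def)
  then have "\<bar>x $ i / h - y $ i / h\<bar> < 1"
    by linarith
  then have "\<bar>(x $ i - y $ i) / h\<bar> < 1"
    by (simp add: diff_divide_distrib)
  with assms(1) show ?thesis
    by simp
qed

lemma cell_eq_norm_dist:
  fixes x y :: "real ^ 'n"
  assumes "h > 0" "cell h x = cell h y"
  shows "norm (x - y) \<le> real CARD('n) * h"
proof -
  have "norm (x - y) \<le> (\<Sum>i\<in>UNIV. \<bar>(x - y) $ i\<bar>)"
    by (rule norm_le_l1_cart)
  also have "\<dots> \<le> (\<Sum>i\<in>(UNIV::'n set). h)"
    using cell_eq_component_dist[OF assms] by (intro sum_mono) (auto intro: less_imp_le)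
  finally show ?thesis by simp
qed

lemma cell_eq_double:
  assumes "cell h x = cell h y"
  shows "cell (2 * h) x = cell (2 * h) y"
proof
  fix i
  have half: "\<lfloor>z / (2 * h)\<rfloor> = \<lfloor>z / h\<rfloor> div 2" for z :: real
    using floor_divide_real_eq_div[of 2 "z / h"] by (simp add: field_simps)
  show "cell (2 * h) x i = cell (2 * h) y i"
    using fun_cong[OF assms, of i] by (simp add: cell_def half)
qed

lemma cell_count_box:
  fixes S :: "(real ^ 'n) set"
  assumes "h > 0" "D \<ge> 0" and S: "\<And>y i. y \<in> S \<Longrightarrow> \<bar>y $ i - x $ i\<bar> \<le> D"
  shows "finite (cell h ` S)" "real (card (cell h ` S)) \<le> (2 * D / h + 2) ^ CARD('n)"
proof -
  define I where "I i = {\<lfloor>(x $ i - D) / h\<rfloor>..\<lfloor>(x $ i + D) / h\<rfloor>}" for i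
  have sub: "cell h ` S \<subseteq> PiE UNIV I"
    using S assms(1)
    by (auto simp: cell_def I_def abs_le_iff field_simps intro!: floor_mono divide_right_mono)
  have fin: "finite (PiE UNIV I)"
    by (intro finite_PiE) (auto simp: I_def)
  show "finite (cell h ` S)"
    by (rule finite_subset[OF sub fin])
  have cI: "real (card (I i)) \<le> 2 * D / h + 2" for i
  proof -
    have "(x $ i + D) / h - (x $ i - D) / h = 2 * D / h"
      by (simp add: diff_divide_distrib[symmetric])
    moreover have "0 \<le> 2 * D / h" using assms by simp
    ultimately show ?thesis unfolding I_def card_atLeastAtMost_int by linarith
  qed
  have "real (card (cell h ` S)) \<le> real (card (PiE UNIV I))"
    using card_mono[OF fin sub] by simp
  also have "\<dots> = (\<Prod>i\<in>UNIV. real (card (I i)))"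
    by (simp add: card_PiE)
  also have "\<dots> \<le> (\<Prod>i\<in>(UNIV::'n set). 2 * D / h + 2)"
    by (intro prod_mono) (auto simp: cI)
  finally show "real (card (cell h ` S)) \<le> (2 * D / h + 2) ^ CARD('n)"
    by simp
qed

lemma cell_count_diameter:
  fixes S :: "(real ^ 'n) set"
  assumes "h > 0" and S: "\<And>x y. x \<in> S \<Longrightarrow> y \<in> S \<Longrightarrow> norm (x - y) \<le> D" and "D \<ge> 0"
  shows "finite (cell h ` S)" "real (card (cell h ` S)) \<le> (2 * D / h + 2) ^ CARD('n)"
proof -
  have "finite (cell h ` S) \<and> real (card (cell h ` S)) \<le> (2 * D / h + 2) ^ CARD('n)"
  proof (cases "S = {}")
    case True
    then show ?thesis using assms(1,3) by simp
  next
    case False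
    then obtain x where x: "x \<in> S" by blast
    have "\<bar>y $ i - x $ i\<bar> \<le> D" if "y \<in> S" for y i
      using S[OF that x] component_le_norm_cart[of "y - x" i] by simp
    from cell_count_box[OF assms(1,3) this] show ?thesis by blast
  qed
  then show "finite (cell h ` S)" "real (card (cell h ` S)) \<le> (2 * D / h + 2) ^ CARD('n)"
    by auto
qed

lemma finite_cells:
  fixes F :: "(real ^ 'n) set"
  assumes "h > 0" "bounded F"
  shows "finite (cell h ` F)"
  using cell_count_diameter(1)[of h F "diameter F"] assms
    diameter_bounded_bound[of F] diameter_ge_0[of F]
  by (auto simp: dist_norm)

lemma cell_count_refine:
  fixes F :: "(real ^ 'n) set"
  assumes "h > 0" "h' > 0" "bounded F"
  shows "real (card (cell h' ` F)) \<le> (2 * h / h' + 2) ^ CARD('n) * real (card (cell h ` F))"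
proof -
  define S where "S l = {x \<in> F. cell h x = l}" for l
  have one: "finite (cell h' ` S l)" "real (card (cell h' ` S l)) \<le> (2 * h / h' + 2) ^ CARD('n)" for l
  proof -
    have "finite (cell h' ` S l) \<and> real (card (cell h' ` S l)) \<le> (2 * h / h' + 2) ^ CARD('n)"
    proof (cases "S l = {}")
      case True
      then show ?thesis using assms by simp
    next
      case False
      then obtain x where x: "x \<in> S l" by blast
      have "\<bar>y $ i - x $ i\<bar> \<le> h" if "y \<in> S l" for y i
        using cell_eq_component_dist[of h y x i] x that assms(1) by (auto simp: S_def)
      from cell_count_box[OF assms(2) less_imp_le[OF assms(1)] this] show ?thesis by blast
    qed
    then show "finite (cell h' ` S l)" "real (card (cell h' ` S l)) \<le> (2 * h / h' + 2) ^ CARD('n)"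
      by auto
  qed
  have fin: "finite (cell h ` F)" using finite_cells assms by blast
  have "cell h' ` F = (\<Union>l\<in>cell h ` F. cell h' ` S l)"
    by (auto simp: S_def)
  then have "real (card (cell h' ` F)) \<le> real (\<Sum>l\<in>cell h ` F. card (cell h' ` S l))"
    using card_UN_le[OF fin, of "\<lambda>l. cell h' ` S l"] by (simp only: of_nat_le_iff)
  also have "\<dots> \<le> (\<Sum>l\<in>cell h ` F. (2 * h / h' + 2) ^ CARD('n))"
    unfolding of_nat_sum by (intro sum_mono one)
  finally show ?thesis by (simp add: mult.commute)
qed

section \<open>Covers and cell counts\<close>

text \<open>
  The cells are replaced by balls of diameter exactly \<open>\<delta>\<close>, because the diameter of the part of \<open>F\<close>
  in a cell may be below the bound \<open>\<delta> powr (1/\<theta>)\<close>. The mesh is fine enough for the ball around any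
  point of \<open>F\<close> in a cell to cover that part.
\<close>

lemma cover_from_cells:
  fixes F :: "(real ^ 'n) set"
  assumes "bounded F" "0 < \<delta>" "\<delta> \<le> 1" "0 < \<theta>" "\<theta> \<le> 1"
    and le: "real (card (cell (\<delta> / (2 * real CARD('n))) ` F)) * \<delta> powr s \<le> \<epsilon>"
  shows "\<exists>C. admissible_cover \<theta> s \<epsilon> \<delta> F C"
proof -
  define h where "h = \<delta> / (2 * real CARD('n))"
  have h: "h > 0" "real CARD('n) * h = \<delta> / 2" using assms by (auto simp: h_def)
  have fin: "finite (cell h ` F)" using finite_cells h assms by blast
  define U where "U l = cball (inv_into F (cell h) l) (\<delta> / 2)" for l
  define C where "C = U ` cell h ` F"
  have dU: "diameter (U l) = \<delta>" for l
    using assms by (simp add: U_def)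
  have finC: "finite C" using fin by (simp add: C_def)
  have "\<delta> powr (1 / \<theta>) \<le> \<delta> powr 1"
    using assms by (intro powr_mono') (auto simp: field_simps)
  then have pw: "\<delta> powr (1 / \<theta>) \<le> \<delta>" using assms by simp
  have "F \<subseteq> \<Union>C"
  proof
    fix x assume x: "x \<in> F"
    let ?y = "inv_into F (cell h) (cell h x)"
    have "cell h ?y = cell h x" using x by (simp add: f_inv_into_f)
    from cell_eq_norm_dist[OF h(1) this] h(2) have "x \<in> U (cell h x)"
      by (simp add: U_def dist_norm)
    then show "x \<in> \<Union>C" using x by (auto simp: C_def)
  qed
  moreover have "(\<Sum>\<^sub>\<infinity>V\<in>C. diameter V powr s) \<le> \<epsilon>"
  proof -
    have "(\<Sum>\<^sub>\<infinity>V\<in>C. diameter V powr s) = (\<Sum>V\<in>C. \<delta> powr s)"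
      unfolding infsum_finite[OF finC] by (rule sum.cong) (auto simp: C_def dU)
    also have "\<dots> \<le> real (card (cell h ` F)) * \<delta> powr s"
      using card_image_le[OF fin, of U] by (simp add: C_def mult_right_mono)
    also have "\<dots> \<le> \<epsilon>" using le by (simp add: h_def)
    finally show ?thesis .
  qed
  ultimately have "admissible_cover \<theta> s \<epsilon> \<delta> F C"
    unfolding admissible_cover_def using finC pw
    by (auto simp: C_def dU) (simp add: U_def)
  then show ?thesis by blast
qed

text \<open>
  The diameters are bounded away from 0, so a summable cover has finitely many members.
\<close>

lemma admissible_cover_finite:
  assumes "admissible_cover \<theta> s \<epsilon> \<delta> F C" "0 < \<delta>" "s \<ge> 0"
  shows "finite C"
proof -
  define c where "c = (\<delta> powr (1 / \<theta>)) powr s"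
  have c: "c > 0" using assms by (simp add: c_def)
  have "c \<le> diameter U powr s" if "U \<in> C" for U
    using assms that unfolding c_def admissible_cover_def by (intro powr_mono2) auto
  note ge = this
  have sm: "(\<lambda>U. diameter U powr s) summable_on C" "(\<Sum>\<^sub>\<infinity>U\<in>C. diameter U powr s) \<le> \<epsilon>"
    using assms by (auto simp: admissible_cover_def)
  have "card G \<le> nat \<lceil>\<epsilon> / c\<rceil>" if G: "finite G" "G \<subseteq> C" for G
  proof -
    have "real (card G) * c \<le> (\<Sum>U\<in>G. diameter U powr s)"
      using sum_bounded_below[of G c "\<lambda>U. diameter U powr s"] ge G by auto
    also have "\<dots> \<le> (\<Sum>\<^sub>\<infinity>U\<in>C. diameter U powr s)"
      using sm G by (intro finite_sum_le_infsum) auto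
    finally have "real (card G) \<le> \<epsilon> / c"
      using sm(2) c by (simp add: field_simps)
    then show ?thesis by linarith
  qed
  then show ?thesis
    by (intro finite_if_finite_subsets_card_bdd[of C "nat \<lceil>\<epsilon> / c\<rceil>", THEN conjunct1]) auto
qed

lemma admissible_cover_mono_theta:
  assumes "admissible_cover \<theta>' s \<epsilon> \<delta> F C" "0 < \<theta>" "\<theta> \<le> \<theta>'" "0 < \<delta>" "\<delta> \<le> 1"
  shows "admissible_cover \<theta> s \<epsilon> \<delta> F C"
proof -
  have "\<delta> powr (1 / \<theta>) \<le> \<delta> powr (1 / \<theta>')"
    using assms by (intro powr_mono') (auto simp: field_simps)
  then show ?thesis using assms(1) by (auto simp: admissible_cover_def)
qed

text \<open>
  Couples the scale \<open>\<delta>\<close> of a cover to the level \<open>k\<close> of a dyadic mesh. Where the choice of \<open>\<beta>\<close> matters, it is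
  \<open>\<gamma>/\<theta>\<close>, so that the mesh has the size to which a \<open>\<gamma>\<close>-Hoelder map sends the smallest admissible
  diameter \<open>\<delta> powr (1/\<theta>)\<close>.
\<close>

definition comparable_scale :: "real \<Rightarrow> real \<Rightarrow> nat \<Rightarrow> bool" where
  "comparable_scale \<beta> \<delta> k \<longleftrightarrow> (1 / 2) ^ k \<le> \<delta> powr \<beta> \<and> \<delta> powr \<beta> \<le> 2 * (1 / 2) ^ k"

text \<open>
  A member \<open>U\<close> of the cover has an image of diameter at most \<open>H |U| powr \<gamma>\<close>, which is at least of the
  order of the mesh and hence meets about \<open>(2\<^sup>k |U| powr \<gamma>)\<^sup>n\<close> cells. Since \<open>|U| \<le> \<delta>\<close>, the excess
  \<open>\<gamma> n - s\<close> of the exponent is paid with \<open>\<delta> powr (\<gamma> n - s)\<close>, and this is the power of \<open>2\<^sup>k\<close> gained over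
  the trivial bound \<open>2\<^sup>k\<^sup>n\<close>.
\<close>

lemma Holder_image_cell_count:
  fixes f :: "'a::euclidean_space \<Rightarrow> real ^ 'n"
  assumes "0 < \<gamma>" "H \<ge> 0" "\<delta> \<le> r" "0 < \<delta>" "s \<ge> 0" "0 < \<theta>"
    and Holder: "\<And>x y. x \<in> E \<Longrightarrow> y \<in> E \<Longrightarrow> dist x y \<le> r \<Longrightarrow> norm (f x - f y) \<le> H * dist x y powr \<gamma>"
    and C: "admissible_cover \<theta> s 1 \<delta> E C"
    and s: "s \<le> \<gamma> * real CARD('n)"
    and k: "comparable_scale (\<gamma> / \<theta>) \<delta> k"
  shows "real (card (cell ((1 / 2) ^ k) ` f ` E))
    \<le> ((2 * H + 2) ^ CARD('n) * 2 powr (\<theta> / \<gamma> * (\<gamma> * real CARD('n) - s)))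
        * (2 ^ k) powr (real CARD('n) - \<theta> / \<gamma> * (\<gamma> * real CARD('n) - s))"
proof -
  let ?n = "CARD('n)"
  define h where "h = (1 / 2 :: real) ^ k"
  have h: "h > 0" "1 / h = 2 ^ k" by (auto simp: h_def power_one_over field_simps)
  have fin: "finite C" using admissible_cover_finite C assms by blast
  have U: "bounded U" "\<delta> powr (1 / \<theta>) \<le> diameter U" "diameter U \<le> \<delta>" if "U \<in> C" for U
    using C that by (auto simp: admissible_cover_def)
  have Upos: "diameter U > 0" if "U \<in> C" for U
    using U(2)[OF that] assms(4) powr_gt_zero[of \<delta> "1 / \<theta>"] by linarith
  have one: "finite (cell h ` f ` (U \<inter> E)) \<and>
      real (card (cell h ` f ` (U \<inter> E))) \<le> ((2 * H + 2) * (diameter U powr \<gamma> / h)) ^ ?n" if "U \<in> C" for U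
  proof -
    let ?D = "H * diameter U powr \<gamma>"
    have "norm (u - v) \<le> ?D" if u: "u \<in> f ` (U \<inter> E)" and v: "v \<in> f ` (U \<inter> E)" for u v
    proof -
      obtain x y where xy: "u = f x" "v = f y" "x \<in> U" "y \<in> U" "x \<in> E" "y \<in> E"
        using u v by blast
      have d: "dist x y \<le> diameter U" using xy U(1)[OF \<open>U \<in> C\<close>] diameter_bounded_bound by blast
      then have "norm (f x - f y) \<le> H * dist x y powr \<gamma>"
        using U(3)[OF \<open>U \<in> C\<close>] assms(3) xy by (intro Holder) auto
      also have "\<dots> \<le> ?D" using d assms by (intro mult_left_mono powr_mono2) auto
      finally show ?thesis using xy by simp
    qed
    note cnt = cell_count_diameter[OF h(1) this]
    have "h \<le> \<delta> powr (\<gamma> / \<theta>)" using k by (simp add: comparable_scale_def h_def)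
    also have "\<dots> = (\<delta> powr (1 / \<theta>)) powr \<gamma>" by (simp add: powr_powr)
    also have "\<dots> \<le> diameter U powr \<gamma>" using U(2)[OF \<open>U \<in> C\<close>] assms by (intro powr_mono2) auto
    finally have "1 \<le> diameter U powr \<gamma> / h" using h by simp
    then have "2 * ?D / h + 2 \<le> (2 * H + 2) * (diameter U powr \<gamma> / h)"
      by (simp add: algebra_simps)
    then have "(2 * ?D / h + 2) ^ ?n \<le> ((2 * H + 2) * (diameter U powr \<gamma> / h)) ^ ?n"
      using h assms by (intro power_mono) auto
    then show ?thesis using cnt assms by fastforce
  qed
  have "cell h ` f ` E = (\<Union>U\<in>C. cell h ` f ` (U \<inter> E))"
    using C unfolding admissible_cover_def by blast
  then have "real (card (cell h ` f ` E)) \<le> real (\<Sum>U\<in>C. card (cell h ` f ` (U \<inter> E)))"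
    using card_UN_le[OF fin, of "\<lambda>U. cell h ` f ` (U \<inter> E)"] by (simp only: of_nat_le_iff)
  also have "\<dots> \<le> (\<Sum>U\<in>C. ((2 * H + 2) * (diameter U powr \<gamma> / h)) ^ ?n)"
    unfolding of_nat_sum by (intro sum_mono) (use one in auto)
  also have "\<dots> \<le> (\<Sum>U\<in>C. (2 * H + 2) ^ ?n * (2 ^ k) ^ ?n * \<delta> powr (\<gamma> * real ?n - s) * diameter U powr s)"
  proof (intro sum_mono)
    fix U assume UC: "U \<in> C"
    have "(diameter U powr \<gamma>) ^ ?n = diameter U powr (\<gamma> * real ?n)"
      using Upos[OF UC] by (simp add: powr_realpow[symmetric] powr_powr)
    also have "\<dots> = diameter U powr (\<gamma> * real ?n - s) * diameter U powr s"
      by (simp add: powr_add[symmetric])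
    also have "\<dots> \<le> \<delta> powr (\<gamma> * real ?n - s) * diameter U powr s"
      using U(3)[OF UC] Upos[OF UC] s by (intro mult_right_mono powr_mono2) auto
    finally have *: "(diameter U powr \<gamma>) ^ ?n \<le> \<delta> powr (\<gamma> * real ?n - s) * diameter U powr s" .
    have "((2 * H + 2) * (diameter U powr \<gamma> / h)) ^ ?n
        = (2 * H + 2) ^ ?n * (2 ^ k) ^ ?n * (diameter U powr \<gamma>) ^ ?n"
      unfolding power_mult_distrib[symmetric] h(2)[symmetric] by (simp add: field_simps)
    also have "\<dots> \<le> (2 * H + 2) ^ ?n * (2 ^ k) ^ ?n * (\<delta> powr (\<gamma> * real ?n - s) * diameter U powr s)"
      using * assms by (intro mult_left_mono) auto
    finally show "((2 * H + 2) * (diameter U powr \<gamma> / h)) ^ ?n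
        \<le> (2 * H + 2) ^ ?n * (2 ^ k) ^ ?n * \<delta> powr (\<gamma> * real ?n - s) * diameter U powr s"
      by (simp add: mult_ac)
  qed
  also have "\<dots> = (2 * H + 2) ^ ?n * (2 ^ k) ^ ?n * \<delta> powr (\<gamma> * real ?n - s) * (\<Sum>U\<in>C. diameter U powr s)"
    by (simp add: sum_distrib_left)
  also have "\<dots> \<le> (2 * H + 2) ^ ?n * (2 ^ k) ^ ?n * \<delta> powr (\<gamma> * real ?n - s) * 1"
    using C fin assms by (intro mult_left_mono) (auto simp: admissible_cover_def)
  also have "\<dots> \<le> (2 * H + 2) ^ ?n * (2 ^ k) ^ ?n *
      (2 powr (\<theta> / \<gamma> * (\<gamma> * real ?n - s)) * (2 ^ k) powr - (\<theta> / \<gamma> * (\<gamma> * real ?n - s)))"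
  proof -
    have "\<delta> powr (\<gamma> * real ?n - s) = (\<delta> powr (\<gamma> / \<theta>)) powr (\<theta> / \<gamma> * (\<gamma> * real ?n - s))"
      using assms by (simp add: powr_powr)
    also have "\<dots> \<le> (2 * h) powr (\<theta> / \<gamma> * (\<gamma> * real ?n - s))"
      using k assms by (intro powr_mono2) (auto simp: comparable_scale_def h_def)
    also have "\<dots> = 2 powr (\<theta> / \<gamma> * (\<gamma> * real ?n - s)) * h powr (\<theta> / \<gamma> * (\<gamma> * real ?n - s))"
      using h by (simp add: powr_mult)
    also have "h powr (\<theta> / \<gamma> * (\<gamma> * real ?n - s)) = (2 ^ k) powr - (\<theta> / \<gamma> * (\<gamma> * real ?n - s))"
      by (simp add: h_def powr_minus power_one_over powr_divide inverse_eq_divide)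
    finally show ?thesis using assms by (simp add: mult_left_mono)
  qed
  also have "\<dots> = ((2 * H + 2) ^ ?n * 2 powr (\<theta> / \<gamma> * (\<gamma> * real ?n - s))) *
      ((2 ^ k) powr real ?n * (2 ^ k) powr - (\<theta> / \<gamma> * (\<gamma> * real ?n - s)))"
    by (simp add: powr_realpow)
  also have "(2 ^ k) powr real ?n * (2 ^ k) powr - (\<theta> / \<gamma> * (\<gamma> * real ?n - s))
      = (2 ^ k :: real) powr (real ?n - \<theta> / \<gamma> * (\<gamma> * real ?n - s))"
    by (simp add: powr_add[symmetric])
  finally show ?thesis by (simp add: h_def)
qed

section \<open>Quantifiers over scales\<close>

lemma tendsto_at_right_Inf:
  fixes f :: "real \<Rightarrow> real"
  assumes mono: "\<And>x y. 0 < x \<Longrightarrow> x \<le> y \<Longrightarrow> y \<le> 1 \<Longrightarrow> f x \<le> f y"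
    and nonneg: "\<And>x. 0 < x \<Longrightarrow> x \<le> 1 \<Longrightarrow> 0 \<le> f x"
  shows "(f \<longlongrightarrow> Inf (f ` {0<..1})) (at_right 0)"
proof (rule order_tendstoI)
  have bdd: "bdd_below (f ` {0<..1})"
    using nonneg by (auto intro!: bdd_belowI[of _ 0])
  have ev: "eventually (\<lambda>x. x \<in> {0<..<y}) (at_right 0)" if "y > 0" for y :: real
    using that by (rule eventually_at_right_real)
  {
    fix a assume a: "a < Inf (f ` {0<..1})"
    have "eventually (\<lambda>x. x \<in> {0<..<1}) (at_right (0::real))" by (rule ev) simp
    then show "eventually (\<lambda>x. a < f x) (at_right 0)"
      by eventually_elim (use a cInf_lower[OF _ bdd] in fastforce)
  next
    fix a assume "Inf (f ` {0<..1}) < a"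
    then obtain y where y: "0 < y" "y \<le> 1" "f y < a"
      using cInf_lessD[of "f ` {0<..1}" a] by auto
    have "eventually (\<lambda>x. x \<in> {0<..<y}) (at_right 0)" by (rule ev[OF y(1)])
    then show "eventually (\<lambda>x. f x < a) (at_right 0)"
    proof eventually_elim
      case (elim x)
      then have "f x \<le> f y" using y by (intro mono) auto
      with y show ?case by simp
    qed
  }
qed

lemma le_Lim_at_right_iff:
  fixes f :: "real \<Rightarrow> real"
  assumes mono: "\<And>x y. 0 < x \<Longrightarrow> x \<le> y \<Longrightarrow> y \<le> 1 \<Longrightarrow> f x \<le> f y"
    and nonneg: "\<And>x. 0 < x \<Longrightarrow> x \<le> 1 \<Longrightarrow> 0 \<le> f x"
  shows "a \<le> Lim (at_right 0) f \<longleftrightarrow> (\<forall>x. 0 < x \<and> x \<le> 1 \<longrightarrow> a \<le> f x)"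
proof -
  have "Lim (at_right 0) f = Inf (f ` {0<..1})"
    by (intro tendsto_Lim tendsto_at_right_Inf assms) auto
  moreover have "bdd_below (f ` {0<..1})"
    using nonneg by (auto intro!: bdd_belowI[of _ 0])
  ultimately show ?thesis
    by (subst \<open>Lim _ _ = _\<close>, subst le_cInf_iff) auto
qed

lemma comparable_scale_ex_nat:
  assumes "0 < \<delta>" "\<delta> \<le> 1" "0 < \<beta>"
  shows "\<exists>k. comparable_scale \<beta> \<delta> k"
proof -
  let ?x = "\<delta> powr \<beta>"
  have x: "0 < ?x" "?x \<le> 1" using assms by (auto intro: powr_le1)
  obtain n where "(1 / 2) ^ n < ?x"
    using x real_arch_pow_inv[of ?x "1 / 2"] by auto
  then have ex: "\<exists>n. (1 / 2) ^ n \<le> ?x" by (auto intro: less_imp_le)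
  define k where "k = (LEAST n. (1 / 2) ^ n \<le> ?x)"
  have "(1 / 2) ^ k \<le> ?x" unfolding k_def by (rule LeastI_ex[OF ex])
  moreover have "?x \<le> 2 * (1 / 2) ^ k"
  proof (cases k)
    case 0
    then show ?thesis using x by simp
  next
    case (Suc j)
    then have "j < k" by simp
    then have "\<not> (1 / 2) ^ j \<le> ?x" unfolding k_def by (rule not_less_Least)
    then show ?thesis using Suc by simp
  qed
  ultimately show ?thesis by (auto simp: comparable_scale_def)
qed

lemma comparable_scale_exact:
  assumes "0 < \<beta>"
  shows "comparable_scale \<beta> (((1 / 2) ^ k) powr (1 / \<beta>)) k"
  using assms by (simp add: comparable_scale_def powr_powr)

lemma exact_scale_tendsto:
  assumes "0 < \<beta>"
  shows "filterlim (\<lambda>k. ((1 / 2) ^ k) powr (1 / \<beta>)) (at_right (0::real)) sequentially"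
proof -
  have "(\<lambda>k. ((1 / 2) powr (1 / \<beta>)) ^ k) \<longlonglongrightarrow> (0::real)"
    using assms powr_less_mono2[of "1 / \<beta>" "1 / 2" 1] by (intro LIMSEQ_realpow_zero) auto
  moreover have "((1 / 2) powr (1 / \<beta>)) ^ k = ((1 / 2) ^ k) powr (1 / \<beta>)" for k
    by (simp add: powr_realpow[symmetric] powr_powr mult.commute)
  ultimately show ?thesis
    by (auto simp: filterlim_at eventually_at_filter)
qed

lemma comparable_scale_large:
  assumes "0 < \<beta>"
  shows "eventually (\<lambda>\<delta>. \<forall>k. comparable_scale \<beta> \<delta> k \<longrightarrow> k \<ge> K) (at_right 0)"
proof -
  let ?b = "((1 / 2) ^ K) powr (1 / \<beta>) :: real"
  have "eventually (\<lambda>x. x \<in> {0<..<?b}) (at_right 0)"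
    by (rule eventually_at_right_real) simp
  then show ?thesis
  proof eventually_elim
    case (elim \<delta>)
    show ?case
    proof (intro allI impI)
      fix k assume k: "comparable_scale \<beta> \<delta> k"
      have "\<delta> powr \<beta> < ?b powr \<beta>"
        using elim assms by (intro powr_less_mono2) auto
      also have "\<dots> = (1 / 2) ^ K" using assms by (simp add: powr_powr)
      finally have "(1 / 2) ^ k < (1 / 2 :: real) ^ K"
        using k unfolding comparable_scale_def by linarith
      then show "k \<ge> K"
        by simp
    qed
  qed
qed

text \<open>
  \<open>Q\<close> quantifies over scales and \<open>QN\<close> over mesh levels. Both stand for "for all small" or both for
  "for arbitrarily small" scales. The last two axioms transport a statement along
  \<^const>\<open>comparable_scale\<close>; they hold for either choice because every small scale has a comparable level
  and every level has a comparable scale.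
\<close>

locale scale_quantifier =
  fixes Q :: "(real \<Rightarrow> bool) \<Rightarrow> bool" and QN :: "(nat \<Rightarrow> bool) \<Rightarrow> bool"
  assumes Q_True: "Q (\<lambda>_. True)"
    and Q_mp: "\<And>P P'. Q P \<Longrightarrow> eventually (\<lambda>\<delta>. P \<delta> \<longrightarrow> P' \<delta>) (at_right 0) \<Longrightarrow> Q P'"
    and QN_mp: "\<And>P P'. QN P \<Longrightarrow> eventually (\<lambda>k. P k \<longrightarrow> P' k) sequentially \<Longrightarrow> QN P'"
    and Q_imp_QN: "\<And>\<beta> P P'. 0 < \<beta> \<Longrightarrow> Q P \<Longrightarrow>
      (\<And>\<delta> k. 0 < \<delta> \<Longrightarrow> comparable_scale \<beta> \<delta> k \<Longrightarrow> P \<delta> \<Longrightarrow> P' k) \<Longrightarrow> QN P'"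
    and QN_imp_Q: "\<And>\<beta> P P'. 0 < \<beta> \<Longrightarrow> QN P' \<Longrightarrow>
      (\<And>\<delta> k. 0 < \<delta> \<Longrightarrow> comparable_scale \<beta> \<delta> k \<Longrightarrow> P' k \<Longrightarrow> P \<delta>) \<Longrightarrow> Q P"

lemma scale_quantifier_eventually:
  "scale_quantifier (\<lambda>P. eventually P (at_right 0)) (\<lambda>P. eventually P sequentially)"
proof
  fix \<beta> :: real and P P'
  assume b: "0 < \<beta>" and P: "eventually P (at_right 0)"
    and imp: "\<And>\<delta> k. 0 < \<delta> \<Longrightarrow> comparable_scale \<beta> \<delta> k \<Longrightarrow> P \<delta> \<Longrightarrow> P' k"
  have "eventually (\<lambda>k. P (((1 / 2) ^ k) powr (1 / \<beta>))) sequentially"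
    using exact_scale_tendsto[OF b] P unfolding filterlim_iff by blast
  then show "eventually P' sequentially"
    by eventually_elim (rule imp[OF _ comparable_scale_exact[OF b]], auto)
next
  fix \<beta> :: real and P P'
  assume b: "0 < \<beta>" and P: "eventually P' sequentially"
    and imp: "\<And>\<delta> k. 0 < \<delta> \<Longrightarrow> comparable_scale \<beta> \<delta> k \<Longrightarrow> P' k \<Longrightarrow> P \<delta>"
  from P obtain K where K: "\<And>k. k \<ge> K \<Longrightarrow> P' k" by (auto simp: eventually_sequentially)
  have "eventually (\<lambda>x. x \<in> {0<..<1}) (at_right (0::real))"
    by (rule eventually_at_right_real) simp
  with comparable_scale_large[OF b, of K] show "eventually P (at_right 0)"
  proof eventually_elim
    case (elim \<delta>)
    then obtain k where "comparable_scale \<beta> \<delta> k"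
      using comparable_scale_ex_nat[of \<delta> \<beta>] b by auto
    with elim K imp show ?case by auto
  qed
next
  fix P P' :: "real \<Rightarrow> bool"
  assume "eventually P (at_right 0)" "eventually (\<lambda>\<delta>. P \<delta> \<longrightarrow> P' \<delta>) (at_right 0)"
  then show "eventually P' (at_right 0)" by (rule eventually_rev_mp)
next
  fix P P' :: "nat \<Rightarrow> bool"
  assume "eventually P sequentially" "eventually (\<lambda>k. P k \<longrightarrow> P' k) sequentially"
  then show "eventually P' sequentially" by (rule eventually_rev_mp)
qed simp

lemma scale_quantifier_frequently:
  "scale_quantifier (\<lambda>P. frequently P (at_right 0)) (\<lambda>P. frequently P sequentially)"
proof
  show "frequently (\<lambda>_. True) (at_right (0::real))" by simp
next
  fix \<beta> :: real and P P'
  assume b: "0 < \<beta>" and P: "frequently P (at_right 0)"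
    and imp: "\<And>\<delta> k. 0 < \<delta> \<Longrightarrow> comparable_scale \<beta> \<delta> k \<Longrightarrow> P \<delta> \<Longrightarrow> P' k"
  show "frequently P' sequentially"
    unfolding frequently_sequentially
  proof
    fix K
    have "eventually (\<lambda>x. x \<in> {0<..<1}) (at_right (0::real))"
      by (rule eventually_at_right_real) simp
    with comparable_scale_large[OF b, of K]
    have "eventually (\<lambda>\<delta>. \<delta> \<in> {0<..<1} \<and> (\<forall>k. comparable_scale \<beta> \<delta> k \<longrightarrow> k \<ge> K)) (at_right 0)"
      by eventually_elim auto
    from frequently_ex[OF frequently_eventually_frequently[OF P this]]
    obtain \<delta> where d: "P \<delta>" "0 < \<delta>" "\<delta> < 1" "\<And>k. comparable_scale \<beta> \<delta> k \<Longrightarrow> k \<ge> K" by auto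
    then obtain k where "comparable_scale \<beta> \<delta> k"
      using comparable_scale_ex_nat[of \<delta> \<beta>] b by auto
    with d imp show "\<exists>n\<ge>K. P' n" by blast
  qed
next
  fix \<beta> :: real and P P'
  assume b: "0 < \<beta>" and P: "frequently P' sequentially"
    and imp: "\<And>\<delta> k. 0 < \<delta> \<Longrightarrow> comparable_scale \<beta> \<delta> k \<Longrightarrow> P' k \<Longrightarrow> P \<delta>"
  show "frequently P (at_right 0)"
    unfolding frequently_def
  proof
    assume "eventually (\<lambda>x. \<not> P x) (at_right 0)"
    then have "eventually (\<lambda>k. \<not> P (((1 / 2) ^ k) powr (1 / \<beta>))) sequentially"
      using exact_scale_tendsto[OF b] unfolding filterlim_iff by blast
    from frequently_ex[OF frequently_eventually_frequently[OF P this]]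
    obtain k where "P' k" "\<not> P (((1 / 2) ^ k) powr (1 / \<beta>))" by auto
    then show False using imp[OF _ comparable_scale_exact[OF b]] by auto
  qed
next
  fix P P' :: "real \<Rightarrow> bool"
  assume "frequently P (at_right 0)" "eventually (\<lambda>\<delta>. P \<delta> \<longrightarrow> P' \<delta>) (at_right 0)"
  then show "frequently P' (at_right 0)" by (rule frequently_rev_mp)
next
  fix P P' :: "nat \<Rightarrow> bool"
  assume "frequently P sequentially" "eventually (\<lambda>k. P k \<longrightarrow> P' k) sequentially"
  then show "frequently P' sequentially" by (rule frequently_rev_mp)
qed

section \<open>Intermediate dimensions of bounded sets\<close>

context scale_quantifier
begin

definition dim_exponents :: "real \<Rightarrow> 'a::euclidean_space set \<Rightarrow> real set" where
  "dim_exponents \<theta> F = {s. s \<ge> 0 \<and> (\<forall>\<epsilon>>0. Q (\<lambda>\<delta>. \<exists>C. admissible_cover \<theta> s \<epsilon> \<delta> F C))}"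

definition intermediate_dim :: "real \<Rightarrow> 'a::euclidean_space set \<Rightarrow> real" where
  "intermediate_dim \<theta> F = Inf (dim_exponents \<theta> F)"

lemma QN_eventually: "eventually P sequentially \<Longrightarrow> QN P"
  using QN_mp[OF Q_imp_QN[OF zero_less_one Q_True, of "\<lambda>_. True"], of P] by simp

lemma intermediate_dim_le: "s \<in> dim_exponents \<theta> F \<Longrightarrow> intermediate_dim \<theta> F \<le> s"
  unfolding intermediate_dim_def
  by (rule cInf_lower) (auto simp: dim_exponents_def intro!: bdd_belowI[of _ 0])

text \<open>
  Covers by balls of diameter \<open>\<delta>\<close> are admissible for every \<open>\<theta>\<close>, which is why a bound on cell counts
  controls all the intermediate dimensions together.
\<close>

lemma dim_exponents_of_cell_count:
  fixes F :: "(real ^ 'n) set"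
  assumes F: "bounded F" and \<theta>: "0 < \<theta>" "\<theta> \<le> 1" and t: "0 \<le> t" "t < s"
    and cnt: "QN (\<lambda>k. real (card (cell ((1 / 2) ^ k) ` F)) \<le> A * (2 ^ k) powr t)"
  shows "s \<in> dim_exponents \<theta> F"
  unfolding dim_exponents_def
proof (intro CollectI conjI allI impI)
  show "0 \<le> s" using t by simp
  fix \<epsilon> :: real assume \<epsilon>: "\<epsilon> > 0"
  define n where "n = CARD('n)"
  have n: "n > 0" by (simp add: n_def)
  define A' where "A' = (4 * real n + 2) ^ n * (max A 0 * 2 powr t)"
  have A': "A' \<ge> 0" by (simp add: A'_def)
  let ?h = "\<lambda>\<delta>. \<delta> / (2 * real n)"
  have Q: "Q (\<lambda>\<delta>. real (card (cell (?h \<delta>) ` F)) \<le> A' * \<delta> powr - t)"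
  proof (rule QN_imp_Q[OF zero_less_one cnt])
    fix \<delta> k
    assume d: "0 < \<delta>" "comparable_scale 1 \<delta> k"
      and c: "real (card (cell ((1 / 2) ^ k) ` F)) \<le> A * (2 ^ k) powr t"
    from d have k: "(1 / 2) ^ k \<le> \<delta>" "\<delta> \<le> 2 * (1 / 2) ^ k"
      by (auto simp: comparable_scale_def)
    have "(2 ^ k) powr t \<le> (2 / \<delta>) powr t"
      using k d t by (intro powr_mono2) (auto simp: field_simps power_one_over)
    also have "\<dots> = 2 powr t * \<delta> powr - t"
      using d by (simp add: powr_divide powr_minus_divide)
    finally have pk: "(2 ^ k) powr t \<le> 2 powr t * \<delta> powr - t" .
    have "real (card (cell (?h \<delta>) ` F))
        \<le> (2 * (1 / 2) ^ k / ?h \<delta> + 2) ^ n * real (card (cell ((1 / 2) ^ k) ` F))"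
      unfolding n_def using cell_count_refine[of "(1 / 2) ^ k" "\<delta> / (2 * real CARD('n))" F] d F by simp
    also have "2 * (1 / 2) ^ k / ?h \<delta> = 4 * real n * ((1 / 2) ^ k / \<delta>)"
      using n d by (simp add: field_simps)
    also have "(4 * real n * ((1 / 2) ^ k / \<delta>) + 2) ^ n * real (card (cell ((1 / 2) ^ k) ` F))
        \<le> (4 * real n * 1 + 2) ^ n * (max A 0 * (2 ^ k) powr t)"
    proof (intro mult_mono power_mono add_mono mult_left_mono order_refl)
      show "(1 / 2) ^ k / \<delta> \<le> 1" using k d by simp
      show "real (card (cell ((1 / 2) ^ k) ` F)) \<le> max A 0 * (2 ^ k) powr t"
        using c by (smt (verit) mult_right_mono powr_ge_zero max.cobounded1)
    qed (use d in auto)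
    also have "\<dots> \<le> (4 * real n * 1 + 2) ^ n * (max A 0 * (2 powr t * \<delta> powr - t))"
      by (intro mult_left_mono pk) auto
    finally show "real (card (cell (?h \<delta>) ` F)) \<le> A' * \<delta> powr - t"
      by (simp add: A'_def mult_left_mono mult_ac)
  qed
  have "((\<lambda>\<delta>. A' * \<delta> powr (s - t)) \<longlongrightarrow> A' * 0) (at_right 0)"
    using t by (intro tendsto_mult tendsto_const tendsto_zero_powrI[OF tendsto_ident_at tendsto_const])
       (auto simp: eventually_at_filter)
  then have e1: "eventually (\<lambda>\<delta>. A' * \<delta> powr (s - t) < \<epsilon>) (at_right 0)"
    using \<epsilon> by (intro order_tendstoD) auto
  have e2: "eventually (\<lambda>x. x \<in> {0<..<1}) (at_right (0::real))"
    by (rule eventually_at_right_real) simp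
  show "Q (\<lambda>\<delta>. \<exists>C. admissible_cover \<theta> s \<epsilon> \<delta> F C)"
  proof (rule Q_mp[OF Q])
    from e1 e2 show "eventually (\<lambda>\<delta>. real (card (cell (?h \<delta>) ` F)) \<le> A' * \<delta> powr - t \<longrightarrow>
        (\<exists>C. admissible_cover \<theta> s \<epsilon> \<delta> F C)) (at_right 0)"
    proof eventually_elim
      case (elim \<delta>)
      show ?case
      proof
        assume "real (card (cell (?h \<delta>) ` F)) \<le> A' * \<delta> powr - t"
        then have "real (card (cell (?h \<delta>) ` F)) * \<delta> powr s \<le> A' * \<delta> powr - t * \<delta> powr s"
          by (intro mult_right_mono) auto
        also have "\<dots> = A' * \<delta> powr (s - t)"
          by (simp add: powr_diff powr_minus field_simps)
        also have "\<dots> \<le> \<epsilon>" using elim by simp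
        finally show "\<exists>C. admissible_cover \<theta> s \<epsilon> \<delta> F C"
          using elim F \<theta> by (intro cover_from_cells) (auto simp: n_def)
      qed
    qed
  qed
qed

text \<open>
  Provides the exponents without which the infimum in the definition of the dimension would be
  taken over the empty set.
\<close>

lemma dim_exponents_gt_dimension:
  fixes F :: "(real ^ 'n) set"
  assumes F: "bounded F" and \<theta>: "0 < \<theta>" "\<theta> \<le> 1" and s: "real CARD('n) < s"
  shows "s \<in> dim_exponents \<theta> F"
proof (rule dim_exponents_of_cell_count[OF F \<theta> _ s])
  let ?D = "diameter F"
  have D: "?D \<ge> 0" using F by (rule diameter_ge_0)
  show "QN (\<lambda>k. real (card (cell ((1 / 2) ^ k) ` F)) \<le> (2 * ?D + 2) ^ CARD('n) * (2 ^ k) powr real CARD('n))"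
  proof (rule QN_eventually, rule always_eventually, rule allI)
    fix k
    have "real (card (cell ((1 / 2) ^ k) ` F)) \<le> (2 * ?D / (1 / 2) ^ k + 2) ^ CARD('n)"
      using diameter_bounded_bound[OF F] D by (intro cell_count_diameter) (auto simp: dist_norm)
    also have "\<dots> \<le> ((2 * ?D + 2) * 2 ^ k) ^ CARD('n)"
      using D one_le_power[of "2::real" k] by (intro power_mono) (auto simp: field_simps power_one_over)
    also have "\<dots> = (2 * ?D + 2) ^ CARD('n) * (2 ^ k) powr real CARD('n)"
      by (simp add: power_mult_distrib powr_realpow)
    finally show "real (card (cell ((1 / 2) ^ k) ` F)) \<le> (2 * ?D + 2) ^ CARD('n) * (2 ^ k) powr real CARD('n)" .
  qed
qed simp

lemma dim_exponents_nonempty: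
  fixes F :: "(real ^ 'n) set"
  assumes "bounded F" "0 < \<theta>" "\<theta> \<le> 1"
  shows "dim_exponents \<theta> F \<noteq> {}"
  using dim_exponents_gt_dimension[OF assms, of "real CARD('n) + 1"] by auto

lemma intermediate_dim_nonneg:
  fixes F :: "(real ^ 'n) set"
  assumes "bounded F" "0 < \<theta>" "\<theta> \<le> 1"
  shows "0 \<le> intermediate_dim \<theta> F"
  unfolding intermediate_dim_def
  by (rule cInf_greatest[OF dim_exponents_nonempty[OF assms]]) (auto simp: dim_exponents_def)

lemma intermediate_dim_le_of_cell_count:
  fixes F :: "(real ^ 'n) set"
  assumes "bounded F" "0 < \<theta>" "\<theta> \<le> 1" "0 \<le> t"
    and "QN (\<lambda>k. real (card (cell ((1 / 2) ^ k) ` F)) \<le> A * (2 ^ k) powr t)"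
  shows "intermediate_dim \<theta> F \<le> t"
  by (rule dense_ge, rule intermediate_dim_le, rule dim_exponents_of_cell_count[OF assms(1-4) _ assms(5)])

lemma intermediate_dim_le_dimension:
  fixes F :: "(real ^ 'n) set"
  assumes "bounded F" "0 < \<theta>" "\<theta> \<le> 1"
  shows "intermediate_dim \<theta> F \<le> real CARD('n)"
  by (rule dense_ge, rule intermediate_dim_le, rule dim_exponents_gt_dimension[OF assms])

lemma dim_exponents_mono_theta:
  assumes "0 < \<theta>" "\<theta> \<le> \<theta>'"
  shows "dim_exponents \<theta>' F \<subseteq> dim_exponents \<theta> F"
proof -
  have e: "eventually (\<lambda>x. x \<in> {0<..<1}) (at_right (0::real))"
    by (rule eventually_at_right_real) simp
  have "Q (\<lambda>\<delta>. \<exists>C. admissible_cover \<theta> s \<epsilon> \<delta> F C)"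
    if "Q (\<lambda>\<delta>. \<exists>C. admissible_cover \<theta>' s \<epsilon> \<delta> F C)" for s \<epsilon>
    using that
  proof (rule Q_mp)
    from e show "eventually (\<lambda>\<delta>. (\<exists>C. admissible_cover \<theta>' s \<epsilon> \<delta> F C) \<longrightarrow>
        (\<exists>C. admissible_cover \<theta> s \<epsilon> \<delta> F C)) (at_right 0)"
    proof eventually_elim
      case (elim \<delta>)
      then show ?case using admissible_cover_mono_theta[of \<theta>' s \<epsilon> \<delta> F _ \<theta>] assms by auto
    qed
  qed
  then show ?thesis by (auto simp: dim_exponents_def)
qed

lemma intermediate_dim_mono_theta:
  fixes F :: "(real ^ 'n) set"
  assumes "bounded F" "0 < \<theta>" "\<theta> \<le> \<theta>'" "\<theta>' \<le> 1"
  shows "intermediate_dim \<theta> F \<le> intermediate_dim \<theta>' F"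
  unfolding intermediate_dim_def
  using dim_exponents_nonempty[of F \<theta>'] dim_exponents_mono_theta[of \<theta> \<theta>' F] assms
  by (intro cInf_superset_mono) (auto simp: dim_exponents_def intro!: bdd_belowI[of _ 0])

text \<open>
  The gain of \<open>Holder_image_cell_count\<close> over the trivial count is a fixed power of \<open>2\<^sup>k\<close>, although
  \<open>\<theta>\<close> may be tiny; so any exponent below \<open>\<gamma> n\<close>, at any \<open>\<theta>\<close>, already forces the counts to be small.
\<close>

lemma cell_count_of_Holder_image:
  fixes f :: "'a::euclidean_space \<Rightarrow> real ^ 'n"
  assumes \<gamma>: "0 < \<gamma>" and H: "H \<ge> 0" and r: "0 < r" and \<theta>: "0 < \<theta>" "\<theta> \<le> 1"
    and Holder: "\<And>x y. x \<in> E \<Longrightarrow> y \<in> E \<Longrightarrow> dist x y \<le> r \<Longrightarrow> norm (f x - f y) \<le> H * dist x y powr \<gamma>"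
    and s: "s \<in> dim_exponents \<theta> E" "s < \<gamma> * real CARD('n)"
  obtains A t where "0 \<le> t" "t < real CARD('n)"
    "QN (\<lambda>k. real (card (cell ((1 / 2) ^ k) ` f ` E)) \<le> A * (2 ^ k) powr t)"
proof -
  let ?n = "real CARD('n)"
  define t where "t = ?n - \<theta> / \<gamma> * (\<gamma> * ?n - s)"
  define A where "A = (2 * H + 2) ^ CARD('n) * 2 powr (\<theta> / \<gamma> * (\<gamma> * ?n - s))"
  have s0: "s \<ge> 0" using s by (simp add: dim_exponents_def)
  have "t = (1 - \<theta>) * ?n + \<theta> * s / \<gamma>" using \<gamma> by (simp add: t_def field_simps)
  then have "0 \<le> t" using \<theta> \<gamma> s0 by simp
  moreover have "t < ?n" using \<theta> \<gamma> s by (simp add: t_def)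
  moreover have "QN (\<lambda>k. real (card (cell ((1 / 2) ^ k) ` f ` E)) \<le> A * (2 ^ k) powr t)"
  proof (rule Q_imp_QN)
    show "0 < \<gamma> / \<theta>" using \<gamma> \<theta> by simp
    have "Q (\<lambda>\<delta>. \<exists>C. admissible_cover \<theta> s 1 \<delta> E C)" using s by (auto simp: dim_exponents_def)
    moreover have "eventually (\<lambda>x. x \<in> {0<..<r}) (at_right (0::real))"
      by (rule eventually_at_right_real[OF r])
    then have "eventually (\<lambda>\<delta>. (\<exists>C. admissible_cover \<theta> s 1 \<delta> E C) \<longrightarrow>
        \<delta> \<le> r \<and> (\<exists>C. admissible_cover \<theta> s 1 \<delta> E C)) (at_right 0)"
      by eventually_elim auto
    ultimately show "Q (\<lambda>\<delta>. \<delta> \<le> r \<and> (\<exists>C. admissible_cover \<theta> s 1 \<delta> E C))" by (rule Q_mp)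
  next
    fix \<delta> k
    assume "0 < \<delta>" "comparable_scale (\<gamma> / \<theta>) \<delta> k"
      "\<delta> \<le> r \<and> (\<exists>C. admissible_cover \<theta> s 1 \<delta> E C)"
    then show "real (card (cell ((1 / 2) ^ k) ` f ` E)) \<le> A * (2 ^ k) powr t"
      unfolding A_def t_def using Holder_image_cell_count[of \<gamma> H \<delta> r s \<theta> E f _ k] \<gamma> H \<theta> s0 s(2) Holder
      by auto
  qed
  ultimately show ?thesis using that by blast
qed

lemma exponent_below_of_dim_less:
  fixes F :: "(real ^ 'n) set"
  assumes "bounded F" "0 < \<theta>" "\<theta> \<le> 1" "intermediate_dim \<theta> F < a"
  obtains s where "s \<in> dim_exponents \<theta> F" "s < a"
  using assms cInf_lessD[OF dim_exponents_nonempty[OF assms(1-3)]]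
  unfolding intermediate_dim_def by blast

lemma intermediate_dim_Holder_image_less:
  fixes f :: "real ^ 'd \<Rightarrow> real ^ 'n"
  assumes "0 < \<gamma>" "H \<ge> 0" "0 < r" "0 < \<theta>" "\<theta> \<le> 1" "0 < \<theta>'" "\<theta>' \<le> 1"
    and "\<And>x y. x \<in> E \<Longrightarrow> y \<in> E \<Longrightarrow> dist x y \<le> r \<Longrightarrow> norm (f x - f y) \<le> H * dist x y powr \<gamma>"
    and "s \<in> dim_exponents \<theta> E" "s < \<gamma> * real CARD('n)" "bounded (f ` E)"
  shows "intermediate_dim \<theta>' (f ` E) < real CARD('n)"
proof -
  obtain A t where "0 \<le> t" "t < real CARD('n)"
    "QN (\<lambda>k. real (card (cell ((1 / 2) ^ k) ` f ` E)) \<le> A * (2 ^ k) powr t)"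
    using cell_count_of_Holder_image[OF assms(1-5,8-10)] by blast
  with intermediate_dim_le_of_cell_count[OF assms(11,6,7)] show ?thesis by fastforce
qed

text \<open>
  The converse of \<open>intermediate_dim_le_of_cell_count\<close> at the top dimension, obtained from
  \<open>cell_count_of_Holder_image\<close> with the identity as the Hoelder map. The countably many exponents
  \<open>n - 1/(j + 1)\<close> suit the later exclusion of a null set for each of them.
\<close>

lemma intermediate_dim_eq_dimension:
  fixes F :: "(real ^ 'n) set"
  assumes F: "bounded F" and \<theta>: "0 < \<theta>" "\<theta> \<le> 1"
    and large: "\<And>j::nat. \<not> QN (\<lambda>k. real (card (cell ((1 / 2) ^ k) ` F))
        \<le> (2 ^ k) powr (real CARD('n) - 1 / real (Suc j)))"
  shows "intermediate_dim \<theta> F = real CARD('n)"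
proof (rule ccontr)
  let ?n = "real CARD('n)"
  assume "intermediate_dim \<theta> F \<noteq> ?n"
  then have "intermediate_dim \<theta> F < ?n"
    using intermediate_dim_le_dimension[OF F \<theta>] by simp
  then obtain s where s: "s \<in> dim_exponents \<theta> F" "s < ?n"
    using exponent_below_of_dim_less[OF F \<theta>] by metis
  obtain A t where t: "0 \<le> t" "t < ?n"
    "QN (\<lambda>k. real (card (cell ((1 / 2) ^ k) ` (\<lambda>x. x) ` F)) \<le> A * (2 ^ k) powr t)"
    by (rule cell_count_of_Holder_image[of 1 1 1 \<theta> F "\<lambda>x. x" s]) (use s \<theta> in \<open>auto simp: dist_norm\<close>)
  obtain j :: nat where j: "inverse (real (Suc j)) < ?n - t"
    using reals_Archimedean[of "?n - t"] t by auto
  let ?u = "?n - 1 / real (Suc j)"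
  have u: "?u - t > 0" using j by (simp add: divide_inverse)
  then have x: "1 < 2 powr (?u - t)" by simp
  obtain N where N: "A < (2 powr (?u - t)) ^ N" using real_arch_pow[OF x] by blast
  have "A \<le> (2 powr (?u - t)) ^ k" if "k \<ge> N" for k
    using power_increasing[OF that less_imp_le[OF x]] N by linarith
  then have "eventually (\<lambda>k. A \<le> (2 powr (?u - t)) ^ k) sequentially"
    by (auto simp: eventually_sequentially)
  then have "eventually (\<lambda>k. A * (2 ^ k) powr t \<le> (2 ^ k) powr ?u) sequentially"
  proof eventually_elim
    case (elim k)
    have "(2 ^ k) powr (?u - t) = (2 powr (?u - t)) ^ k"
      by (simp add: powr_realpow[symmetric] powr_powr mult.commute)
    then have "A * (2 ^ k) powr t \<le> (2 ^ k) powr (?u - t) * (2 ^ k) powr t"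
      using elim by (intro mult_right_mono) auto
    also have "\<dots> = (2 ^ k) powr ?u" by (simp add: powr_add[symmetric])
    finally show ?case .
  qed
  then have "QN (\<lambda>k. real (card (cell ((1 / 2) ^ k) ` F)) \<le> (2 ^ k) powr ?u)"
    by (intro QN_mp[OF t(3)]) (auto elim: eventually_mono)
  with large show False by blast
qed

end

interpretation lower: scale_quantifier "\<lambda>P. frequently P (at_right 0)" "\<lambda>P. frequently P sequentially"
  by (rule scale_quantifier_frequently)

interpretation upper: scale_quantifier "\<lambda>P. eventually P (at_right 0)" "\<lambda>P. eventually P sequentially"
  by (rule scale_quantifier_eventually)

lemma lower_intermediate_dim_eq: "lower.intermediate_dim = lower_intermediate_dim"
proof (intro ext)
  fix \<theta> and F :: "'a set"
  have "frequently P (at_right 0) \<longleftrightarrow> (\<forall>\<delta>0>0. \<exists>\<delta>. 0 < \<delta> \<and> \<delta> \<le> \<delta>0 \<and> P \<delta>)" (is "?L \<longleftrightarrow> ?R") for P :: "real \<Rightarrow> bool"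
  proof
    assume L: ?L
    show ?R
    proof (intro allI impI)
      fix b :: real assume "b > 0"
      then have "eventually (\<lambda>x. x \<in> {0<..<b}) (at_right 0)"
        by (rule eventually_at_right_real)
      from frequently_ex[OF frequently_eventually_frequently[OF L this]]
      show "\<exists>\<delta>. 0 < \<delta> \<and> \<delta> \<le> b \<and> P \<delta>" by force
    qed
  next
    assume R: ?R
    show ?L unfolding frequently_def eventually_at_right_field
    proof safe
      fix b :: real assume b: "b > 0" "\<forall>y>0. y < b \<longrightarrow> \<not> P y"
      with R[rule_format, of "b / 2"] show False by auto
    qed
  qed
  then show "lower.intermediate_dim \<theta> F = lower_intermediate_dim \<theta> F"
    unfolding lower.intermediate_dim_def lower.dim_exponents_def lower_intermediate_dim_def by simp
qed

lemma upper_intermediate_dim_eq: "upper.intermediate_dim = upper_intermediate_dim"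
proof (intro ext)
  fix \<theta> and F :: "'a set"
  have "eventually P (at_right 0) \<longleftrightarrow> (\<exists>\<delta>0>0. \<forall>\<delta>. 0 < \<delta> \<and> \<delta> \<le> \<delta>0 \<longrightarrow> P \<delta>)" (is "?L \<longleftrightarrow> ?R") for P :: "real \<Rightarrow> bool"
  proof
    assume ?L
    then obtain b where b: "b > 0" "\<forall>y>0. y < b \<longrightarrow> P y" by (auto simp: eventually_at_right_field)
    then show ?R by (intro exI[of _ "b / 2"]) auto
  next
    assume ?R
    then show ?L by (force simp: eventually_at_right_field)
  qed
  then show "upper.intermediate_dim \<theta> F = upper_intermediate_dim \<theta> F"
    unfolding upper.intermediate_dim_def upper.dim_exponents_def upper_intermediate_dim_def by simp
qed

section \<open>Frostman weights on a finite tree\<close>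

lemma nested_labels_le:
  fixes c :: "nat \<Rightarrow> 'a \<Rightarrow> 'b"
  assumes "\<And>j p q. c j p = c j q \<Longrightarrow> c (Suc j) p = c (Suc j) q" "c i p = c i q" "i \<le> j"
  shows "c j p = c j q"
  using assms(3) by (induction j rule: dec_induct) (auto intro: assms)

text \<open>
  The points of \<open>P\<close> are the leaves of a tree, \<open>c j\<close> assigns to a leaf its ancestor at height \<open>j\<close>, and
  \<open>v j\<close> is the capacity of the nodes at that height. Going up the tree, the mass below every
  overloaded node is scaled down to its capacity. A leaf is below a saturated node at the start, and
  stays so: if no scaling affects it its node is unchanged, otherwise the scaled node is saturated.
\<close>

lemma tree_weights:
  fixes c :: "nat \<Rightarrow> 'a \<Rightarrow> 'b" and v :: "nat \<Rightarrow> real"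
  assumes fin: "finite P"
    and nested: "\<And>j p q. c j p = c j q \<Longrightarrow> c (Suc j) p = c (Suc j) q"
    and v: "\<And>j. v j > 0"
  shows "\<exists>w. (\<forall>p. 0 \<le> w p) \<and> (\<forall>j\<le>J. \<forall>p\<in>P. sum w {q\<in>P. c j q = c j p} \<le> v j) \<and>
     (\<forall>p\<in>P. \<exists>j\<le>J. sum w {q\<in>P. c j q = c j p} = v j)"
proof (induction J)
  case 0
  let ?w = "\<lambda>q. v 0 / real (card {q'\<in>P. c 0 q' = c 0 q})"
  have "sum ?w {q\<in>P. c 0 q = c 0 p} = v 0" if "p \<in> P" for p
  proof -
    have "sum ?w {q\<in>P. c 0 q = c 0 p} = (\<Sum>q\<in>{q\<in>P. c 0 q = c 0 p}. v 0 / real (card {q'\<in>P. c 0 q' = c 0 p}))"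
      by (rule sum.cong) auto
    moreover have "card {q'\<in>P. c 0 q' = c 0 p} > 0"
      using that fin by (auto simp: card_gt_0_iff)
    ultimately show ?thesis by simp
  qed
  then show ?case using less_imp_le[OF v[of 0]] by (intro exI[of _ ?w]) auto
next
  case (Suc J)
  then obtain w where w: "\<And>p. 0 \<le> w p"
    "\<And>j p. j \<le> J \<Longrightarrow> p \<in> P \<Longrightarrow> sum w {q\<in>P. c j q = c j p} \<le> v j"
    "\<And>p. p \<in> P \<Longrightarrow> \<exists>j\<le>J. sum w {q\<in>P. c j q = c j p} = v j" by blast
  define m where "m p = sum w {q\<in>P. c (Suc J) q = c (Suc J) p}" for p
  define w' where "w' p = (if m p \<le> v (Suc J) then w p else w p * (v (Suc J) / m p))" for p
  have m_eq: "m q = m p" if "c (Suc J) q = c (Suc J) p" for p q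
    using that by (simp add: m_def)
  have w'0: "0 \<le> w' p" for p
    using w(1)[of p] v[of "Suc J"] by (simp add: w'_def)
  have w'_le: "w' p \<le> w p" for p
  proof -
    have "v (Suc J) / m p \<le> 1" if "\<not> m p \<le> v (Suc J)"
      using that v[of "Suc J"] by simp
    then show ?thesis using mult_left_le[OF _ w(1)] unfolding w'_def by (simp del: times_divide_eq_right)
  qed
  have top: "sum w' {q\<in>P. c (Suc J) q = c (Suc J) p} = min (m p) (v (Suc J))" for p
  proof (cases "m p \<le> v (Suc J)")
    case True
    then have "sum w' {q\<in>P. c (Suc J) q = c (Suc J) p} = sum w {q\<in>P. c (Suc J) q = c (Suc J) p}"
    proof (intro sum.cong refl)
      fix q assume "q \<in> {q\<in>P. c (Suc J) q = c (Suc J) p}"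
      then have "m q = m p" by (intro m_eq) simp
      with True show "w' q = w q" by (simp add: w'_def)
    qed
    then show ?thesis using True by (simp add: m_def)
  next
    case False
    then have "sum w' {q\<in>P. c (Suc J) q = c (Suc J) p}
        = (\<Sum>q\<in>{q\<in>P. c (Suc J) q = c (Suc J) p}. w q * (v (Suc J) / m p))"
    proof (intro sum.cong refl)
      fix q assume "q \<in> {q\<in>P. c (Suc J) q = c (Suc J) p}"
      then have "m q = m p" by (intro m_eq) simp
      with False show "w' q = w q * (v (Suc J) / m p)" by (simp add: w'_def)
    qed
    also have "\<dots> = m p * (v (Suc J) / m p)"
      by (simp only: sum_distrib_right[symmetric] m_def)
    finally show ?thesis using False v[of "Suc J"] by simp
  qed
  show ?case
  proof (intro exI[of _ w'] conjI allI ballI impI)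
    fix j p assume j: "j \<le> Suc J" and p: "p \<in> P"
    show "sum w' {q\<in>P. c j q = c j p} \<le> v j"
    proof (cases "j = Suc J")
      case True
      then show ?thesis using top by simp
    next
      case False
      have "sum w' {q\<in>P. c j q = c j p} \<le> sum w {q\<in>P. c j q = c j p}"
        by (intro sum_mono w'_le)
      then show ?thesis using w(2)[of j p] False j p by simp
    qed
  next
    fix p assume p: "p \<in> P"
    show "\<exists>j\<le>Suc J. sum w' {q\<in>P. c j q = c j p} = v j"
    proof (cases "m p \<le> v (Suc J)")
      case True
      obtain j where j: "j \<le> J" "sum w {q\<in>P. c j q = c j p} = v j" using w(3)[OF p] by blast
      have "sum w' {q\<in>P. c j q = c j p} = sum w {q\<in>P. c j q = c j p}"
      proof (rule sum.cong)
        fix q assume "q \<in> {q\<in>P. c j q = c j p}"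
        then have "c (Suc J) q = c (Suc J) p"
          by (intro nested_labels_le[of c j q p "Suc J", OF nested]) (use j in auto)
        then show "w' q = w q" using True m_eq[of q p] by (simp add: w'_def)
      qed simp
      then show ?thesis using j by (intro exI[of _ j]) auto
    next
      case False
      then show ?thesis using top[of p] by (intro exI[of _ "Suc J"]) auto
    qed
  qed (rule w'0)
qed

text \<open>
  The highest saturated nodes are pairwise incomparable, so their leaves partition \<open>P\<close> and the total
  mass is the sum of their capacities. This identity turns a small total mass into a cheap cover.
\<close>

lemma saturated_classes_partition:
  fixes c :: "nat \<Rightarrow> 'a \<Rightarrow> 'b" and v :: "nat \<Rightarrow> real" and w :: "'a \<Rightarrow> real"
  assumes fin: "finite P"
    and nested: "\<And>j p q. c j p = c j q \<Longrightarrow> c (Suc j) p = c (Suc j) q"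
    and sat: "\<And>p. p \<in> P \<Longrightarrow> \<exists>j\<le>J. sum w {q\<in>P. c j q = c j p} = v j"
  shows "\<exists>T. finite T \<and> T \<subseteq> {..J} \<times> P \<and> (\<forall>p\<in>P. \<exists>(j, q)\<in>T. c j p = c j q) \<and>
     (\<Sum>(j, q)\<in>T. v j) = sum w P"
proof -
  \<comment> \<open>\<open>g p\<close> is the height of the highest saturated node above \<open>p\<close>.\<close>
  define A where "A p = {j. j \<le> J \<and> sum w {q\<in>P. c j q = c j p} = v j}" for p
  define g where "g p = Max (A p)" for p
  define cls where "cls p = {q\<in>P. c (g p) q = c (g p) p}" for p
  have finA: "finite (A p)" for p
    by (rule finite_subset[of _ "{..J}"]) (auto simp: A_def)
  have g_in: "g p \<in> A p" if "p \<in> P" for p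
    unfolding g_def using finA sat[OF that] by (intro Max_in) (auto simp: A_def)
  have g_ge: "j \<le> g p" if "j \<in> A p" for j p
    unfolding g_def using finA that by (rule Max_ge)
  have A_cong: "j \<in> A q" if "j \<in> A p" "c j q = c j p" for j p q
    using that by (simp add: A_def)
  have g_cls: "g q = g p" if "p \<in> P" "q \<in> cls p" for p q
  proof (rule antisym)
    have q: "q \<in> P" "c (g p) q = c (g p) p" using that by (auto simp: cls_def)
    show le: "g p \<le> g q" using g_ge[OF A_cong[OF g_in[OF that(1)] q(2)]] .
    have "c (g q) p = c (g q) q"
      by (rule nested_labels_le[of c "g p", OF nested _ le]) (simp_all add: q)
    then show "g q \<le> g p" using g_ge[OF A_cong[OF g_in[OF q(1)]]] by blast
  qed
  have cls_cls: "cls q = cls p" if "p \<in> P" "q \<in> cls p" for p q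
    using g_cls[OF that] that by (auto simp: cls_def)
  define R where "R = cls ` P"
  define rep where "rep = inv_into P cls"
  have rep: "rep X \<in> P" "cls (rep X) = X" if "X \<in> R" for X
    using that inv_into_into[of X cls P] f_inv_into_f[of X cls P] by (auto simp: R_def rep_def)
  have finR: "finite R" using fin by (simp add: R_def)
  define T where "T = (\<lambda>X. (g (rep X), rep X)) ` R"
  have inj: "inj_on (\<lambda>X. (g (rep X), rep X)) R"
    by (rule inj_onI) (metis rep(2) prod.inject)
  have "(\<Sum>(j, q)\<in>T. v j) = (\<Sum>X\<in>R. v (g (rep X)))"
    unfolding T_def by (subst sum.reindex[OF inj]) simp
  also have "\<dots> = (\<Sum>X\<in>R. sum w X)"
  proof (rule sum.cong)
    fix X assume X: "X \<in> R"
    have "sum w (cls (rep X)) = v (g (rep X))"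
      using g_in[OF rep(1)[OF X]] by (simp add: A_def cls_def)
    then show "v (g (rep X)) = sum w X" using rep(2)[OF X] by simp
  qed simp
  also have "\<dots> = sum w (\<Union>R)"
  proof (subst sum.Union_disjoint)
    show "\<forall>A\<in>R. finite A" using fin by (auto simp: R_def cls_def)
    show "\<forall>A\<in>R. \<forall>B\<in>R. A \<noteq> B \<longrightarrow> A \<inter> B = {}"
    proof (intro ballI impI, rule ccontr)
      fix A B assume AB: "A \<in> R" "B \<in> R" "A \<noteq> B" "A \<inter> B \<noteq> {}"
      then obtain x p q where "x \<in> cls p" "x \<in> cls q" "A = cls p" "B = cls q" "p \<in> P" "q \<in> P"
        by (auto simp: R_def)
      then show False using cls_cls[of p x] cls_cls[of q x] AB by simp
    qed
  qed simp
  also have "\<Union>R = P" by (auto simp: R_def cls_def)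
  finally have sumT: "(\<Sum>(j, q)\<in>T. v j) = sum w P" .
  have "\<exists>(j, q)\<in>T. c j p = c j q" if p: "p \<in> P" for p
  proof -
    have X: "cls p \<in> R" using p by (simp add: R_def)
    let ?q = "rep (cls p)"
    have "p \<in> cls ?q" using rep(2)[OF X] p by (simp add: cls_def)
    then have "c (g ?q) p = c (g ?q) ?q" by (simp add: cls_def)
    moreover have "(g ?q, ?q) \<in> T" using X by (simp add: T_def)
    ultimately show ?thesis by blast
  qed
  moreover have "T \<subseteq> {..J} \<times> P"
    using rep(1) g_in by (auto simp: T_def A_def)
  ultimately show ?thesis using finR sumT by (intro exI[of _ T]) (auto simp: T_def)
qed

text \<open>
  The tree consists of meshes whose sides double from height to height, and a cell of height \<open>j\<close> has
  the capacity \<open>(2\<^sup>j \<rho>) powr s\<close>, which is what it costs in a cover. Balls around the highest saturated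
  cells form an admissible cover that costs at most the total mass, so that mass exceeds \<open>\<epsilon>\<close>. A ball
  of radius the side of the mesh meets at most \<open>4\<^sup>d\<close> cells.
\<close>

lemma Frostman_weights:
  fixes E :: "(real ^ 'd) set"
  assumes E: "bounded E" and \<rho>: "0 < \<delta>" "\<rho> = \<delta> powr (1 / \<theta>)" "2 ^ J * \<rho> \<le> \<delta>"
    and no_cover: "\<not> (\<exists>C. admissible_cover \<theta> s \<epsilon> \<delta> E C)"
  obtains P w where "finite P" "P \<subseteq> E" "\<And>p. 0 \<le> w p" "\<epsilon> < sum w P"
    "\<And>x j. j \<le> J \<Longrightarrow> sum w {q\<in>P. norm (x - q) \<le> \<rho> * 2 ^ j / (2 * real CARD('d))}
        \<le> 4 ^ CARD('d) * (2 ^ j * \<rho>) powr s"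
proof -
  \<comment> \<open>A ball of diameter exactly \<open>2\<^sup>j \<rho>\<close> around any point of a cell of side \<open>h j\<close> contains the cell.\<close>
  define n where "n = CARD('d)"
  have n: "n > 0" by (simp add: n_def)
  have \<rho>0: "\<rho> > 0" using \<rho> by simp
  define h where "h j = \<rho> * 2 ^ j / (2 * real n)" for j
  have h: "h j > 0" for j using \<rho>0 n by (simp add: h_def)
  have h_Suc: "h (Suc j) = 2 * h j" for j by (simp add: h_def)
  define c :: "nat \<Rightarrow> real ^ 'd \<Rightarrow> 'd \<Rightarrow> int" where "c j = cell (h j)" for j
  have nested: "c (Suc j) p = c (Suc j) q" if "c j p = c j q" for j p q
    using cell_eq_double that by (simp add: c_def h_Suc)
  define v where "v j = (2 ^ j * \<rho>) powr s" for j :: nat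
  have v: "v j > 0" for j using \<rho>0 by (simp add: v_def)
  define P where "P = inv_into E (c 0) ` c 0 ` E"
  have finP: "finite P" using finite_cells[OF h E] by (simp add: P_def c_def)
  have PE: "P \<subseteq> E" by (auto simp: P_def intro: inv_into_into)
  have repr: "\<exists>p\<in>P. \<forall>j. c j x = c j p" if "x \<in> E" for x
  proof
    let ?p = "inv_into E (c 0) (c 0 x)"
    show "?p \<in> P" using that by (simp add: P_def)
    have "c 0 x = c 0 ?p" using that by (simp add: f_inv_into_f)
    then show "\<forall>j. c j x = c j ?p" using nested_labels_le[of c 0 x ?p, OF nested] by blast
  qed
  obtain w where w: "\<And>p. 0 \<le> w p"
      "\<And>j p. j \<le> J \<Longrightarrow> p \<in> P \<Longrightarrow> sum w {q\<in>P. c j q = c j p} \<le> v j"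
      "\<And>p. p \<in> P \<Longrightarrow> \<exists>j\<le>J. sum w {q\<in>P. c j q = c j p} = v j"
    using tree_weights[of P c v J, OF finP nested v] by blast
  obtain T where T: "finite T" "T \<subseteq> {..J} \<times> P" "\<And>p. p \<in> P \<Longrightarrow> \<exists>(j, q)\<in>T. c j p = c j q"
      "(\<Sum>(j, q)\<in>T. v j) = sum w P"
    using saturated_classes_partition[of P c J w v, OF finP nested w(3)] by blast
  define B where "B = (\<lambda>(j :: nat, q :: real ^ 'd). cball q (2 ^ j * \<rho> / 2))"
  have diam: "diameter (B t) = 2 ^ fst t * \<rho>" for t
  proof -
    have "0 \<le> 2 ^ fst t * \<rho>" using \<rho>0 by simp
    then show ?thesis by (simp add: B_def case_prod_unfold not_less)
  qed
  have "\<not> sum w P \<le> \<epsilon>"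
  proof
    assume le: "sum w P \<le> \<epsilon>"
    have "admissible_cover \<theta> s \<epsilon> \<delta> E (B ` T)"
      unfolding admissible_cover_def
    proof (intro conjI ballI)
      show "E \<subseteq> \<Union> (B ` T)"
      proof
        fix x assume "x \<in> E"
        then obtain p where p: "p \<in> P" "\<And>j. c j x = c j p" using repr by blast
        obtain j q where q: "(j, q) \<in> T" "c j p = c j q" using T(3)[OF p(1)] by blast
        have "norm (x - q) \<le> real n * h j"
          using cell_eq_norm_dist[OF h, of j x q] p q by (simp add: c_def n_def)
        also have "\<dots> = 2 ^ j * \<rho> / 2" using n by (simp add: h_def)
        finally have "x \<in> B (j, q)" by (simp add: B_def dist_norm norm_minus_commute)
        then show "x \<in> \<Union> (B ` T)" using q by blast
      qed
    next
      fix U assume "U \<in> B ` T"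
      then obtain t where t: "t \<in> T" "U = B t" by blast
      then have "fst t \<le> J" using T(2) by auto
      then have "2 ^ fst t * \<rho> \<le> 2 ^ J * \<rho>" using \<rho>0 by (intro mult_right_mono power_increasing) auto
      moreover have "1 * \<rho> \<le> 2 ^ fst t * \<rho>" using \<rho>0 by (intro mult_right_mono) auto
      ultimately show "\<delta> powr (1 / \<theta>) \<le> diameter U" "diameter U \<le> \<delta>"
        unfolding \<rho>(2)[symmetric] t(2) diam using \<rho>(3) by linarith+
      show "bounded U" using t by (cases "t") (simp add: B_def)
    next
      show "(\<lambda>U. diameter U powr s) summable_on B ` T" using T(1) by simp
      have "(\<Sum>\<^sub>\<infinity>U\<in>B ` T. diameter U powr s) = (\<Sum>U\<in>B ` T. diameter U powr s)"
        using T(1) by simp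
      also have "\<dots> \<le> sum ((\<lambda>U. diameter U powr s) \<circ> B) T"
        using T(1) by (intro sum_image_le) auto
      also have "\<dots> = (\<Sum>(j, q)\<in>T. v j)"
        by (intro sum.cong) (auto simp: diam v_def)
      finally show "(\<Sum>\<^sub>\<infinity>U\<in>B ` T. diameter U powr s) \<le> \<epsilon>" using T(4) le by simp
    qed
    with no_cover show False by blast
  qed
  then have big: "\<epsilon> < sum w P" by simp
  have ball: "sum w {q\<in>P. norm (x - q) \<le> \<rho> * 2 ^ j / (2 * real CARD('d))}
        \<le> 4 ^ CARD('d) * (2 ^ j * \<rho>) powr s" if j: "j \<le> J" for x j
  proof -
    define X where "X = {q\<in>P. norm (x - q) \<le> h j}"
    have finX: "finite X" using finP by (simp add: X_def)
    have "\<bar>q $ i - x $ i\<bar> \<le> h j" if "q \<in> X" for q i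
      using that component_le_norm_cart[of "x - q" i] by (auto simp: X_def)
    have cnt: "real (card (c j ` X)) \<le> 4 ^ n"
      using cell_count_box(2)[OF h[of j] less_imp_le[OF h[of j]], of X x] h[of j]
        \<open>\<And>q i. q \<in> X \<Longrightarrow> \<bar>q $ i - x $ i\<bar> \<le> h j\<close> by (simp add: c_def n_def)
    have "sum w X = (\<Sum>l\<in>c j ` X. sum w {q\<in>X. c j q = l})"
      by (rule sum.image_gen[OF finX])
    also have "\<dots> \<le> (\<Sum>l\<in>c j ` X. v j)"
    proof (rule sum_mono)
      fix l assume "l \<in> c j ` X"
      then obtain p where p: "p \<in> X" "l = c j p" by blast
      have "sum w {q\<in>X. c j q = l} \<le> sum w {q\<in>P. c j q = c j p}"
        using finP w(1) p by (intro sum_mono2) (auto simp: X_def)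
      also have "\<dots> \<le> v j" using w(2)[OF j] p by (simp add: X_def)
      finally show "sum w {q\<in>X. c j q = l} \<le> v j" .
    qed
    also have "\<dots> \<le> 4 ^ n * v j" using cnt v[of j] by (simp add: mult_right_mono)
    finally show ?thesis by (simp add: X_def h_def n_def v_def)
  qed
  show ?thesis by (rule that[OF finP PE w(1) big ball])
qed

section \<open>Potentials and label counts\<close>

text \<open>
  Dyadic summation: the mass at distance about \<open>2\<^sup>j \<rho> / b\<close> from \<open>p\<close> is of order \<open>(2\<^sup>j \<rho>) powr s\<close> and
  contributes with the factor \<open>(2 powr (- j)) powr a\<close>, which is a geometric series because \<open>s < a\<close>. The
  second summand bounds the contribution of the points farther away than the last radius.
\<close>

lemma Riesz_potential_bound:
  fixes p :: "'a::real_normed_vector" and w \<kappa> :: "'a \<Rightarrow> real"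
  assumes finP: "finite P" and w: "\<And>q. 0 \<le> w q" and \<rho>: "0 < \<rho>" and s: "0 \<le> s" "s < a" and b: "1 \<le> b" and M: "0 \<le> M"
    and ball: "\<And>j. j \<le> J \<Longrightarrow> sum w {q\<in>P. norm (p - q) \<le> \<rho> * 2 ^ j / b} \<le> M * (2 ^ j * \<rho>) powr s"
    and \<kappa>1: "\<And>q. q \<in> P \<Longrightarrow> \<kappa> q \<le> 1"
    and \<kappa>: "\<And>q. q \<in> P \<Longrightarrow> q \<noteq> p \<Longrightarrow> \<kappa> q \<le> (\<rho> / norm (p - q)) powr a"
  shows "(\<Sum>q\<in>P. w q * \<kappa> q)
    \<le> (2 * b) powr a * (M / (1 - 2 powr (s - a)) * \<rho> powr s + (1 / 2 ^ Suc J) powr a * sum w P)"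
proof -
  define h where "h j = \<rho> * 2 ^ j / b" for j
  have h: "h j > 0" for j using \<rho> b by (simp add: h_def)
  define c where "c j = (2 * b / 2 ^ j) powr a" for j :: nat
  have c0: "c j \<ge> 0" for j by (simp add: c_def)
  have far: "\<kappa> q \<le> c (Suc j)" if q: "q \<in> P" "h j < norm (p - q)" for q j
  proof -
    have "q \<noteq> p" using q h[of j] by auto
    then have "\<kappa> q \<le> (\<rho> / norm (p - q)) powr a" using \<kappa> q by blast
    also have "\<dots> \<le> (\<rho> / h j) powr a"
      using q h[of j] \<rho> s by (intro powr_mono2 divide_left_mono) (auto intro!: divide_nonneg_nonneg mult_pos_pos)
    also have "\<rho> / h j = 2 * b / 2 ^ Suc j" using \<rho> b by (simp add: h_def)
    finally show ?thesis by (simp add: c_def)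
  qed
  have pt: "\<kappa> q \<le> (\<Sum>j\<le>J. if norm (p - q) \<le> h j then c j else 0) + c (Suc J)" if q: "q \<in> P" for q
  proof (cases "\<exists>j\<le>J. norm (p - q) \<le> h j")
    case False
    then have "\<kappa> q \<le> c (Suc J)" using far[OF q, of J] by auto
    moreover have "0 \<le> (\<Sum>j\<le>J. if norm (p - q) \<le> h j then c j else 0)"
      using c0 by (intro sum_nonneg) auto
    ultimately show ?thesis by linarith
  next
    case True
    define j where "j = (LEAST j. norm (p - q) \<le> h j)"
    from True obtain i where i: "i \<le> J" "norm (p - q) \<le> h i" by blast
    have j1: "norm (p - q) \<le> h j" unfolding j_def by (rule LeastI[of _ i]) (rule i)
    have "j \<le> i" unfolding j_def by (rule Least_le) (rule i)
    then have j2: "j \<le> J" using i by simp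
    have "\<kappa> q \<le> c j"
    proof (cases j)
      case 0
      have "1 \<le> (2 * b) powr a" using b s by (intro ge_one_powr_ge_zero) auto
      then show ?thesis using \<kappa>1[OF q] 0 by (simp add: c_def)
    next
      case (Suc i)
      then have "i < j" by simp
      then have "\<not> norm (p - q) \<le> h i" unfolding j_def by (rule not_less_Least)
      then show ?thesis using far[OF q, of i] Suc by auto
    qed
    also have "c j \<le> (\<Sum>j\<le>J. if norm (p - q) \<le> h j then c j else 0)"
      using member_le_sum[of j "{..J}" "\<lambda>j. if norm (p - q) \<le> h j then c j else 0"] j1 j2 c0 by auto
    finally show ?thesis using c0[of "Suc J"] by linarith
  qed
  have "(\<Sum>q\<in>P. w q * \<kappa> q) \<le> (\<Sum>q\<in>P. w q * ((\<Sum>j\<le>J. if norm (p - q) \<le> h j then c j else 0) + c (Suc J)))"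
    using pt w by (intro sum_mono mult_left_mono) auto
  also have "\<dots> = (\<Sum>q\<in>P. \<Sum>j\<le>J. (if norm (p - q) \<le> h j then c j * w q else 0)) + c (Suc J) * sum w P"
    by (simp add: distrib_left sum.distrib sum_distrib_left sum_distrib_right mult.commute if_distrib cong: if_cong)
  also have "(\<Sum>q\<in>P. \<Sum>j\<le>J. (if norm (p - q) \<le> h j then c j * w q else 0))
      = (\<Sum>j\<le>J. c j * sum w {q\<in>P. norm (p - q) \<le> h j})"
    using finP by (subst sum.swap) (auto simp: sum.inter_filter sum_distrib_left intro!: sum.cong)
  also have "\<dots> \<le> (\<Sum>j\<le>J. c j * (M * (2 ^ j * \<rho>) powr s))"
    using ball c0 by (intro sum_mono mult_left_mono) (auto simp: h_def)
  also have "\<dots> = (2 * b) powr a * M * \<rho> powr s * (\<Sum>j\<le>J. (2 powr (s - a)) ^ j)"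
  proof -
    have "c j * (M * (2 ^ j * \<rho>) powr s) = (2 * b) powr a * M * \<rho> powr s * (2 powr (s - a)) ^ j" for j
    proof -
      have "(2 powr (s - a)) ^ j = (2 ^ j) powr (s - a)"
        by (simp add: powr_realpow[symmetric] powr_powr mult.commute)
      then show ?thesis using \<rho> b by (simp add: c_def powr_divide powr_mult powr_diff)
    qed
    then show ?thesis by (simp only: sum_distrib_left)
  qed
  also have "\<dots> \<le> (2 * b) powr a * M * \<rho> powr s * (1 / (1 - 2 powr (s - a)))"
  proof (intro mult_left_mono)
    let ?x = "2 powr (s - a) :: real"
    have x: "0 < ?x" "?x < 1" using s by (auto simp: powr_less_one)
    have "(\<Sum>j\<le>J. ?x ^ j) = (1 - ?x ^ Suc J) / (1 - ?x)"
      using x s by (simp add: sum_gp0)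
    also have "\<dots> \<le> 1 / (1 - ?x)" using x by (intro divide_right_mono) auto
    finally show "(\<Sum>j\<le>J. ?x ^ j) \<le> 1 / (1 - ?x)" .
  qed (use M in auto)
  also have "c (Suc J) = (2 * b) powr a * (1 / 2 ^ Suc J) powr a"
    unfolding c_def using b by (subst powr_mult[symmetric]) auto
  finally show ?thesis by (simp add: algebra_simps)
qed

text \<open>
  Cauchy-Schwarz for the masses of the label classes: if few pairs share a label, then many labels
  occur.
\<close>

lemma Cauchy_Schwarz_label_count:
  fixes w :: "'a \<Rightarrow> real" and l :: "'a \<Rightarrow> 'b"
  assumes "finite P"
  shows "(sum w P)\<^sup>2 \<le> real (card (l ` P)) * (\<Sum>p\<in>P. \<Sum>q\<in>P. if l p = l q then w p * w q else 0)"
proof -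
  define m where "m y = sum w {q\<in>P. l q = y}" for y
  have "(sum w P)\<^sup>2 = (\<Sum>y\<in>l ` P. m y)\<^sup>2"
    unfolding m_def by (subst sum.image_gen[OF assms, of w l]) simp
  also have "\<dots> \<le> real (card (l ` P)) * (\<Sum>y\<in>l ` P. (m y)\<^sup>2)"
    using sum_squared_le_sum_of_squares[of m "l ` P"] by (simp add: mult.commute)
  also have "(\<Sum>y\<in>l ` P. (m y)\<^sup>2) = (\<Sum>y\<in>l ` P. \<Sum>p\<in>{p\<in>P. l p = y}. w p * m (l p))"
    by (intro sum.cong) (auto simp: power2_eq_square m_def sum_distrib_right)
  also have "\<dots> = (\<Sum>p\<in>P. w p * m (l p))"
    by (rule sum.image_gen[OF assms, symmetric])
  also have "\<dots> = (\<Sum>p\<in>P. \<Sum>q\<in>P. if l p = l q then w p * w q else 0)"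
    using assms by (simp add: m_def sum.inter_filter sum_distrib_left eq_commute if_distrib cong: if_cong)
  finally show ?thesis .
qed

section \<open>Gaussian increments\<close>

lemma normal_density_le:
  assumes "0 < \<sigma>"
  shows "normal_density \<mu> \<sigma> x \<le> 1 / (2 * \<sigma>)"
proof -
  have "2 * \<sigma> = sqrt (4 * \<sigma>\<^sup>2)"
    using assms by (simp add: real_sqrt_mult)
  also have "\<dots> \<le> sqrt (2 * pi * \<sigma>\<^sup>2)"
    using pi_ge_two by (intro real_sqrt_le_mono mult_right_mono) auto
  finally have "1 / sqrt (2 * pi * \<sigma>\<^sup>2) \<le> 1 / (2 * \<sigma>)"
    using assms by (intro divide_left_mono) auto
  moreover have "exp (- (x - \<mu>)\<^sup>2 / (2 * \<sigma>\<^sup>2)) \<le> 1" by simp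
  ultimately have "1 / sqrt (2 * pi * \<sigma>\<^sup>2) * exp (- (x - \<mu>)\<^sup>2 / (2 * \<sigma>\<^sup>2)) \<le> 1 / (2 * \<sigma>) * 1"
    using assms by (intro mult_mono) auto
  then show ?thesis by (simp add: normal_density_def)
qed

context prob_space
begin

lemma normal_small_ball:
  assumes D: "distributed M lborel X (normal_density 0 \<sigma>)" and \<sigma>: "0 < \<sigma>" and r: "0 \<le> r"
  shows "prob (X -` {-r..r} \<inter> space M) \<le> r / \<sigma>"
proof -
  have "emeasure M (X -` {-r..r} \<inter> space M)
      = (\<integral>\<^sup>+x. ennreal (normal_density 0 \<sigma> x) * indicator {-r..r} x \<partial>lborel)"
    by (rule distributed_emeasure[OF D]) simp
  also have "\<dots> \<le> (\<integral>\<^sup>+x. ennreal (1 / (2 * \<sigma>)) * indicator {-r..r} x \<partial>lborel)"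
    using normal_density_le[OF \<sigma>] by (intro nn_integral_mono mult_right_mono ennreal_leI) auto
  also have "\<dots> = ennreal (1 / (2 * \<sigma>)) * ennreal (2 * r)"
    using r by (simp add: nn_integral_cmult)
  also have "\<dots> = ennreal (r / \<sigma>)"
    using r \<sigma> by (simp add: ennreal_mult[symmetric])
  finally show ?thesis
    using r \<sigma> by (simp add: emeasure_eq_measure)
qed

text \<open>
  Markov's inequality for the moment of order \<open>2 p\<close>. The order is left free because any polynomial
  number of increments has to be controlled at once in \<open>grid_oscillation_prob\<close>.
\<close>

lemma normal_tail:
  assumes D: "distributed M lborel X (normal_density 0 \<sigma>)" and \<sigma>: "0 < \<sigma>" and u: "0 < u"
  shows "prob {\<omega> \<in> space M. u \<le> \<bar>X \<omega>\<bar>} \<le> fact (2 * p) * (\<sigma> / u) ^ (2 * p)"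
proof -
  have X[measurable]: "X \<in> borel_measurable M"
    using distributed_measurable[OF D] by simp
  have int: "integrable lborel (\<lambda>x. normal_density 0 \<sigma> x * x ^ (2 * p))"
    using integrable_normal_moment[OF \<sigma>, of 0 "2 * p"] by simp
  have I: "integrable M (\<lambda>\<omega>. X \<omega> ^ (2 * p))"
    using distributed_integrable[OF D, of "\<lambda>x. x ^ (2 * p)"] int by simp
  have E: "expectation (\<lambda>\<omega>. X \<omega> ^ (2 * p)) = fact (2 * p) / ((2 / \<sigma>\<^sup>2) ^ p * fact p)"
    using distributed_integral[OF D, of "\<lambda>x. x ^ (2 * p)"] integral_normal_moment_even[OF \<sigma>, of 0 p] by simp
  have "{\<omega> \<in> space M. u \<le> \<bar>X \<omega>\<bar>} = {\<omega> \<in> space M. u ^ (2 * p) \<le> X \<omega> ^ (2 * p)}" if "p > 0"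
  proof -
    have "u \<le> \<bar>x\<bar> \<longleftrightarrow> u ^ (2 * p) \<le> x ^ (2 * p)" for x
      using power_mono_iff[of u "\<bar>x\<bar>" "2 * p"] u that by (simp add: power_even_abs)
    then show ?thesis by simp
  qed
  then have "prob {\<omega> \<in> space M. u \<le> \<bar>X \<omega>\<bar>} \<le> prob {\<omega> \<in> space M. u ^ (2 * p) \<le> X \<omega> ^ (2 * p)}"
    by (cases "p = 0") (auto intro!: finite_measure_mono)
  also have "\<dots> \<le> expectation (\<lambda>\<omega>. X \<omega> ^ (2 * p)) / u ^ (2 * p)"
    using u by (intro integral_Markov_inequality_measure[OF I, of "{}"]) auto
  also have "\<dots> \<le> fact (2 * p) * (\<sigma> / u) ^ (2 * p)"
  proof -
    have "fact (2 * p) / ((2 / \<sigma>\<^sup>2) ^ p * fact p) = fact (2 * p) * \<sigma> ^ (2 * p) / (2 ^ p * fact p)"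
      using \<sigma> by (simp add: power_divide power_mult[symmetric])
    also have "\<dots> \<le> fact (2 * p) * \<sigma> ^ (2 * p) / 1"
    proof (intro divide_left_mono)
      have "1 * 1 \<le> (2 ^ p :: real) * fact p"
        by (intro mult_mono) (auto simp: fact_ge_1)
      then show "1 \<le> (2 ^ p :: real) * fact p" by simp
    qed (use \<sigma> in auto)
    finally have "fact (2 * p) / ((2 / \<sigma>\<^sup>2) ^ p * fact p) / u ^ (2 * p) \<le> fact (2 * p) * \<sigma> ^ (2 * p) / 1 / u ^ (2 * p)"
      using u by (intro divide_right_mono) auto
    then show ?thesis unfolding E by (simp only: power_divide times_divide_eq_right div_by_1)
  qed
  finally show ?thesis .
qed

end

context fractional_Brownian_motion
begin

lemma component_measurable: "(\<lambda>\<omega>. B \<omega> x $ i) \<in> borel_measurable M"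
proof -
  have "(\<lambda>\<omega> x. B \<omega> x $ i) \<in> measurable M (Pi\<^sub>M UNIV (\<lambda>_. borel))"
    using independent by (auto simp: indep_vars_def)
  then show ?thesis by (rule measurable_compose) (rule measurable_component_singleton, simp)
qed

text \<open>
  By independence of the components the one-dimensional bound is raised to the power \<open>m\<close>; this is
  where the threshold \<open>\<alpha> m\<close> of the theorem comes from.
\<close>

lemma joint_small_ball:
  assumes xy: "x \<noteq> y" and r: "0 \<le> r"
  shows "prob {\<omega> \<in> space M. \<forall>i. \<bar>B \<omega> x $ i - B \<omega> y $ i\<bar> \<le> r} \<le> (r / norm (x - y) powr \<alpha>) ^ CARD('m)"
proof -
  define Z where "Z i \<omega> = B \<omega> x $ i - B \<omega> y $ i" for i \<omega>
  have ind: "indep_vars (\<lambda>_. borel) (\<lambda>i \<omega>. (\<lambda>f. f x - f y) (\<lambda>x. B \<omega> x $ i)) UNIV"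
    by (rule indep_vars_compose2[OF independent]) auto
  have "{\<omega> \<in> space M. \<forall>i. \<bar>B \<omega> x $ i - B \<omega> y $ i\<bar> \<le> r} = (\<Inter>i\<in>UNIV. Z i -` {-r..r} \<inter> space M)"
    by (auto simp: Z_def abs_le_iff) (smt (verit))+
  then have "prob {\<omega> \<in> space M. \<forall>i. \<bar>B \<omega> x $ i - B \<omega> y $ i\<bar> \<le> r} = (\<Prod>i\<in>UNIV. prob (Z i -` {-r..r} \<inter> space M))"
    using indep_varsD_finite[OF ind, of "\<lambda>_. {-r..r}"] by (simp add: Z_def[abs_def])
  also have "\<dots> \<le> (\<Prod>i\<in>(UNIV :: 'm set). r / norm (x - y) powr \<alpha>)"
    using normal_small_ball[OF increments[OF xy] _ r] xy by (intro prod_mono) (auto simp: Z_def[abs_def])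
  finally show ?thesis by simp
qed

lemma component_tail:
  assumes xy: "x \<noteq> y" and u: "0 < u"
  shows "prob {\<omega> \<in> space M. u \<le> \<bar>B \<omega> x $ i - B \<omega> y $ i\<bar>} \<le> fact (2 * p) * (norm (x - y) powr \<alpha> / u) ^ (2 * p)"
  using normal_tail[OF increments[OF xy] _ u] xy by simp

lemma AE_continuous: "AE \<omega> in M. continuous_on UNIV (B \<omega>)"
proof -
  have "AE \<omega> in M. \<forall>i\<in>(UNIV :: 'm set). continuous_on UNIV (\<lambda>x. B \<omega> x $ i)"
    using continuous by (intro AE_finite_allI) auto
  then show ?thesis
  proof eventually_elim
    case (elim \<omega>)
    then have "continuous_on UNIV (\<lambda>x. \<chi> i. B \<omega> x $ i)"
      by (intro continuous_on_vec_lambda) auto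
    then show ?case by simp
  qed
qed

end

section \<open>Hoelder continuity of the paths\<close>

definition dyadic_floor :: "nat \<Rightarrow> real ^ 'd \<Rightarrow> real ^ 'd" where
  "dyadic_floor n x = (\<chi> i. of_int \<lfloor>2 ^ n * x $ i\<rfloor> / 2 ^ n)"

definition dyadic_grid :: "int \<Rightarrow> nat \<Rightarrow> (real ^ 'd) set" where
  "dyadic_grid R n = (\<lambda>v. \<chi> i. of_int (v i) / 2 ^ n) ` (PiE UNIV (\<lambda>_. {- R * 2 ^ n..R * 2 ^ n}))"

lemma dyadic_gridI:
  assumes "\<And>i. \<exists>z. p $ i = of_int z / 2 ^ n \<and> \<bar>z\<bar> \<le> R * 2 ^ n"
  shows "p \<in> dyadic_grid R n"
proof -
  from assms obtain v where v: "\<And>i. p $ i = of_int (v i) / 2 ^ n" "\<And>i. \<bar>v i\<bar> \<le> R * 2 ^ n"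
    by metis
  show ?thesis unfolding dyadic_grid_def
  proof (rule image_eqI)
    show "p = (\<chi> i. of_int (v i) / 2 ^ n)" by (simp add: vec_eq_iff v(1))
    show "v \<in> PiE UNIV (\<lambda>_. {- R * 2 ^ n..R * 2 ^ n})"
    proof (rule PiE_I)
      fix i
      show "v i \<in> {- R * 2 ^ n..R * 2 ^ n}" using v(2)[of i] by (simp add: abs_le_iff)
    qed simp
  qed
qed

lemma finite_dyadic_grid: "finite (dyadic_grid R n :: (real ^ 'd) set)"
  unfolding dyadic_grid_def by (intro finite_imageI finite_PiE) auto

lemma card_dyadic_grid_le:
  assumes "0 \<le> R"
  shows "real (card (dyadic_grid R n :: (real ^ 'd) set)) \<le> ((2 * real_of_int R + 1) * 2 ^ n) ^ CARD('d)"
proof -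
  let ?I = "PiE (UNIV :: 'd set) (\<lambda>_. {- R * 2 ^ n..R * 2 ^ n})"
  have "finite ?I" by (intro finite_PiE) auto
  then have "card (dyadic_grid R n :: (real ^ 'd) set) \<le> card ?I"
    unfolding dyadic_grid_def by (rule card_image_le)
  also have "\<dots> = nat (2 * R * 2 ^ n + 1) ^ CARD('d)"
    by (simp add: card_PiE algebra_simps)
  finally have "real (card (dyadic_grid R n :: (real ^ 'd) set)) \<le> real (nat (2 * R * 2 ^ n + 1)) ^ CARD('d)"
    by (metis of_nat_le_iff of_nat_power)
  also have "real (nat (2 * R * 2 ^ n + 1)) = 2 * real_of_int R * 2 ^ n + 1" using assms by simp
  also have "(2 * real_of_int R * 2 ^ n + 1) ^ CARD('d) \<le> ((2 * real_of_int R + 1) * 2 ^ n) ^ CARD('d)"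
    using assms by (intro power_mono) (auto simp: algebra_simps)
  finally show ?thesis .
qed

lemma dyadic_floor_close: "\<bar>dyadic_floor n x $ i - x $ i\<bar> \<le> (1 / 2) ^ n"
proof -
  have "\<bar>of_int \<lfloor>2 ^ n * x $ i\<rfloor> - 2 ^ n * x $ i\<bar> \<le> 1" by linarith
  then have "\<bar>of_int \<lfloor>2 ^ n * x $ i\<rfloor> - 2 ^ n * x $ i\<bar> / 2 ^ n \<le> 1 / 2 ^ n"
    by (intro divide_right_mono) auto
  also have "\<bar>of_int \<lfloor>2 ^ n * x $ i\<rfloor> - 2 ^ n * x $ i\<bar> / 2 ^ n = \<bar>dyadic_floor n x $ i - x $ i\<bar>"
  proof -
    have "dyadic_floor n x $ i - x $ i = (of_int \<lfloor>2 ^ n * x $ i\<rfloor> - 2 ^ n * x $ i) / 2 ^ n"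
      by (simp add: dyadic_floor_def diff_divide_distrib)
    then show ?thesis by (simp only: abs_divide) simp
  qed
  finally show ?thesis by (simp add: power_one_over)
qed

text \<open>
  The finer grid is allowed so that two consecutive approximations of a point lie in a common grid.
  The margin 1 in the hypothesis absorbs the rounding.
\<close>

lemma dyadic_floor_in_grid:
  assumes x: "\<And>i. \<bar>x $ i\<bar> \<le> real_of_int R - 1"
  shows "dyadic_floor n x \<in> dyadic_grid R (n + k)"
proof (rule dyadic_gridI)
  fix i
  let ?z = "\<lfloor>2 ^ n * x $ i\<rfloor>"
  have "\<bar>2 ^ n * x $ i\<bar> \<le> 2 ^ n * (real_of_int R - 1)"
    using x[of i] by (simp add: abs_mult)
  moreover have "1 \<le> (2 :: real) ^ n" by simp
  ultimately have "\<bar>real_of_int ?z\<bar> \<le> real_of_int R * 2 ^ n"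
    by (simp only: right_diff_distrib mult.commute[of _ "2 ^ n"]) linarith
  then have z: "\<bar>?z\<bar> \<le> R * 2 ^ n"
    by (metis (mono_tags, lifting) of_int_abs of_int_le_iff of_int_mult of_int_numeral of_int_power)
  show "\<exists>z. dyadic_floor n x $ i = of_int z / 2 ^ (n + k) \<and> \<bar>z\<bar> \<le> R * 2 ^ (n + k)"
  proof (intro exI conjI)
    show "dyadic_floor n x $ i = of_int (?z * 2 ^ k) / 2 ^ (n + k)"
      by (simp add: dyadic_floor_def power_add)
    have "\<bar>?z * 2 ^ k\<bar> = \<bar>?z\<bar> * 2 ^ k" by (simp add: abs_mult)
    also have "\<dots> \<le> R * 2 ^ n * 2 ^ k" by (intro mult_right_mono z) simp
    finally show "\<bar>?z * 2 ^ k\<bar> \<le> R * 2 ^ (n + k)" by (simp add: power_add mult_ac)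
  qed
qed

lemma dyadic_floor_tendsto: "(\<lambda>n. dyadic_floor n x) \<longlonglongrightarrow> x"
proof (rule vec_tendstoI)
  fix i
  have "(\<lambda>n. (1 / 2) ^ n) \<longlonglongrightarrow> (0 :: real)" by (intro LIMSEQ_realpow_zero) auto
  moreover have "eventually (\<lambda>n. norm (dyadic_floor n x $ i - x $ i) \<le> (1 / 2) ^ n) sequentially"
    by (intro always_eventually allI) (simp only: real_norm_def dyadic_floor_close)
  ultimately have "(\<lambda>n. dyadic_floor n x $ i - x $ i) \<longlonglongrightarrow> 0"
    by (rule Lim_null_comparison[rotated])
  then show "(\<lambda>n. dyadic_floor n x $ i) \<longlonglongrightarrow> x $ i" by (simp add: LIM_zero_iff)
qed

text \<open>
  The chaining argument of Kolmogorov and Chentsov: \<open>f x\<close> is reached from its value at the dyadic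
  approximation of \<open>x\<close> of level \<open>n\<close> by increments over finer and finer grids, whose bounds form a
  geometric series. For two points the level \<open>n\<close> is chosen with \<open>2\<^sup>-\<^sup>n\<close> comparable to their distance;
  their approximations are then neighbours in the grid, and \<open>3\<close> mesh sizes bound all the grid steps
  that occur.
\<close>

lemma dyadic_chaining:
  fixes f :: "real ^ 'd \<Rightarrow> 'b::real_normed_vector"
  assumes cont: "continuous_on UNIV f" and \<gamma>: "0 < \<gamma>" and K: "0 \<le> K"
    and grid: "\<And>n p q. N \<le> n \<Longrightarrow> p \<in> dyadic_grid R n \<Longrightarrow> q \<in> dyadic_grid R n \<Longrightarrow>
      (\<And>i. \<bar>p $ i - q $ i\<bar> \<le> 3 * (1 / 2) ^ n) \<Longrightarrow> norm (f p - f q) \<le> K * ((1 / 2) powr \<gamma>) ^ n"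
    and x: "\<And>i. \<bar>x $ i\<bar> \<le> real_of_int R - 1" and y: "\<And>i. \<bar>y $ i\<bar> \<le> real_of_int R - 1"
    and xy: "dist x y \<le> (1 / 2) ^ N"
  shows "norm (f x - f y) \<le> K * (2 / (1 - (1 / 2) powr \<gamma>) + 1) * 2 powr \<gamma> * dist x y powr \<gamma>"
proof -
  define b where "b = (1 / 2 :: real) powr \<gamma>"
  have b: "0 < b" "b < 1" using \<gamma> powr_less_mono2[of \<gamma> "1 / 2" 1] by (auto simp: b_def)
  define c where "c = 1 / (1 - b)"
  have c: "c > 0" "c * (1 - b) = 1" using b by (auto simp: c_def)
  have floor_approx: "norm (f z - f (dyadic_floor n z)) \<le> K * b ^ n * c"
    if z: "\<And>i. \<bar>z $ i\<bar> \<le> real_of_int R - 1" and n: "N \<le> n" for z n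
  proof -
    have step: "norm (f (dyadic_floor (n + j) z) - f (dyadic_floor n z)) \<le> K * b ^ n * c * (1 - b ^ j)" for j
    proof (induction j)
      case 0
      then show ?case by simp
    next
      case (Suc j)
      have close: "\<bar>dyadic_floor (n + Suc j) z $ i - dyadic_floor (n + j) z $ i\<bar> \<le> 3 * (1 / 2) ^ (n + Suc j)" for i
      proof -
        have "(1 / 2 :: real) ^ (n + j) = 2 * (1 / 2) ^ (n + Suc j)" by simp
        then show ?thesis
          using dyadic_floor_close[of "n + Suc j" z i] dyadic_floor_close[of "n + j" z i] by linarith
      qed
      have "norm (f (dyadic_floor (n + Suc j) z) - f (dyadic_floor (n + j) z)) \<le> K * b ^ (n + Suc j)"
        unfolding b_def
      proof (rule grid)
        show "dyadic_floor (n + Suc j) z \<in> dyadic_grid R (n + Suc j)"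
          using dyadic_floor_in_grid[OF z, of "n + Suc j" 0] by simp
        show "dyadic_floor (n + j) z \<in> dyadic_grid R (n + Suc j)"
          using dyadic_floor_in_grid[OF z, of "n + j" 1] by simp
      qed (use n close in auto)
      also have "K * b ^ (n + Suc j) = K * b ^ n * (c * (1 - b)) * b ^ j * b"
        unfolding c(2) by (simp add: power_add)
      also have "\<dots> = K * b ^ n * c * (b ^ j - b ^ Suc j) * b"
        by (simp add: algebra_simps)
      also have "\<dots> \<le> K * b ^ n * c * (b ^ j - b ^ Suc j) * 1"
        using b c K by (intro mult_left_mono mult_nonneg_nonneg) (auto simp: mult_le_cancel_right2)
      finally have "norm (f (dyadic_floor (n + Suc j) z) - f (dyadic_floor (n + j) z))
          \<le> K * b ^ n * c * (b ^ j - b ^ Suc j)" by simp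
      with Suc.IH norm_triangle_ineq[of "f (dyadic_floor (n + Suc j) z) - f (dyadic_floor (n + j) z)"
          "f (dyadic_floor (n + j) z) - f (dyadic_floor n z)"]
      show ?case by (simp add: algebra_simps)
    qed
    have "(\<lambda>j. dyadic_floor (j + n) z) \<longlonglongrightarrow> z"
      by (rule LIMSEQ_ignore_initial_segment[OF dyadic_floor_tendsto])
    then have "(\<lambda>j. f (dyadic_floor (j + n) z)) \<longlonglongrightarrow> f z"
      using cont by (intro isCont_tendsto_compose[of z f]) (auto simp: continuous_on_eq_continuous_at)
    then have "(\<lambda>j. norm (f (dyadic_floor (j + n) z) - f (dyadic_floor n z))) \<longlonglongrightarrow> norm (f z - f (dyadic_floor n z))"
      by (intro tendsto_norm tendsto_diff tendsto_const)
    then show ?thesis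
    proof (rule LIMSEQ_le_const2)
      have "norm (f (dyadic_floor (j + n) z) - f (dyadic_floor n z)) \<le> K * b ^ n * c" for j
      proof -
        have "K * b ^ n * c * (1 - b ^ j) \<le> K * b ^ n * c * 1"
          using K b c by (intro mult_left_mono mult_nonneg_nonneg) auto
        with step[of j] show ?thesis by (simp add: add.commute)
      qed
      then show "\<exists>N'. \<forall>j\<ge>N'. norm (f (dyadic_floor (j + n) z) - f (dyadic_floor n z)) \<le> K * b ^ n * c"
        by blast
    qed
  qed
  show ?thesis
  proof (cases "x = y")
    case True
    then show ?thesis by simp
  next
    case False
    then have d: "0 < dist x y" by simp
    define n where "n = (LEAST n. (1 / 2) ^ Suc n < dist x y)"
    obtain i where "(1 / 2) ^ i < dist x y"
      using d real_arch_pow_inv[of "dist x y" "1 / 2"] by auto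
    then have "(1 / 2) ^ Suc i < dist x y" using d by (simp, linarith)
    then have n1: "(1 / 2) ^ Suc n < dist x y" unfolding n_def by (rule LeastI)
    have n2: "dist x y \<le> (1 / 2) ^ n"
    proof (cases n)
      case 0
      have "(1 / 2 :: real) ^ N \<le> 1" by (intro power_le_one) auto
      then show ?thesis using xy 0 by simp
    next
      case (Suc j)
      then have "j < n" by simp
      then have "\<not> (1 / 2) ^ Suc j < dist x y" unfolding n_def by (rule not_less_Least)
      then show ?thesis using Suc by simp
    qed
    have nN: "N \<le> n"
    proof (rule ccontr)
      assume "\<not> N \<le> n"
      then have "(1 / 2 :: real) ^ N \<le> (1 / 2) ^ Suc n" by (intro power_decreasing) auto
      with n1 xy show False by simp
    qed
    have close: "\<bar>dyadic_floor n x $ i - dyadic_floor n y $ i\<bar> \<le> 3 * (1 / 2) ^ n" for i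
    proof -
      have "\<bar>x $ i - y $ i\<bar> \<le> (1 / 2) ^ n"
        using component_le_norm_cart[of "x - y" i] n2 by (simp add: dist_norm)
      then show ?thesis
        using dyadic_floor_close[of n x i] dyadic_floor_close[of n y i] by linarith
    qed
    have "norm (f (dyadic_floor n x) - f (dyadic_floor n y)) \<le> K * b ^ n"
      unfolding b_def
      using dyadic_floor_in_grid[OF x, of n 0] dyadic_floor_in_grid[OF y, of n 0] nN close
      by (intro grid) auto
    moreover have "norm (f x - f y) \<le> norm (f x - f (dyadic_floor n x))
        + norm (f (dyadic_floor n x) - f (dyadic_floor n y)) + norm (f y - f (dyadic_floor n y))"
      by (smt (verit, ccfv_SIG) norm_diff_triangle_ineq norm_minus_commute norm_triangle_sub add_diff_cancel diff_diff_add norm_triangle_ineq4 diff_add_cancel)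
    ultimately have "norm (f x - f y) \<le> K * b ^ n * c + K * b ^ n + K * b ^ n * c"
      using floor_approx[OF x nN] floor_approx[OF y nN] by linarith
    also have "\<dots> = K * (2 * c + 1) * b ^ n" by (simp add: algebra_simps)
    also have "\<dots> \<le> K * (2 * c + 1) * (2 * dist x y) powr \<gamma>"
    proof (intro mult_left_mono)
      have "b ^ n = ((1 / 2) ^ n) powr \<gamma>"
        by (simp add: b_def powr_realpow[symmetric] powr_powr mult.commute)
      also have "\<dots> \<le> (2 * dist x y) powr \<gamma>"
        using n1 \<gamma> by (intro powr_mono2) auto
      finally show "b ^ n \<le> (2 * dist x y) powr \<gamma>" .
    qed (use K c in auto)
    finally show ?thesis by (simp add: powr_mult c_def b_def mult_ac)
  qed
qed

context fractional_Brownian_motion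
begin

text \<open>
  A union bound over the pairs of close grid points. There are at most a constant times \<open>2 powr (2 d n)\<close> of
  them, and each fails with probability at most a constant times \<open>2 powr (- 2 p (\<alpha> - \<gamma>) n)\<close> for any \<open>p\<close>;
  a large \<open>p\<close> beats the number of pairs.
\<close>

lemma grid_oscillation_prob:
  assumes \<gamma>: "\<gamma> < \<alpha>" "0 < \<alpha>" and R: "0 \<le> R"
  defines "bad \<equiv> \<lambda>n. {\<omega> \<in> space M. \<exists>p\<in>dyadic_grid R n. \<exists>q\<in>dyadic_grid R n. p \<noteq> q \<and>
      (\<forall>i. \<bar>p $ i - q $ i\<bar> \<le> 3 * (1 / 2) ^ n) \<and> (\<exists>i. ((1 / 2) powr \<gamma>) ^ n \<le> \<bar>B \<omega> p $ i - B \<omega> q $ i\<bar>)}"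
  shows "bad n \<in> events" "\<exists>C. \<forall>n. prob (bad n) \<le> C * (1 / 2) ^ n"
proof -
  note [measurable] = component_measurable
  define I where "I n = {(p, q, i). p \<in> (dyadic_grid R n :: (real ^ 'd) set) \<and> q \<in> dyadic_grid R n \<and> p \<noteq> q \<and>
      (\<forall>i. \<bar>p $ i - q $ i\<bar> \<le> 3 * (1 / 2) ^ n) \<and> i \<in> (UNIV :: 'm set)}" for n
  define A where "A n = (\<lambda>(p, q, i). {\<omega> \<in> space M. ((1 / 2) powr \<gamma>) ^ n \<le> \<bar>B \<omega> p $ i - B \<omega> q $ i\<bar>})" for n
  have I_sub: "I n \<subseteq> dyadic_grid R n \<times> dyadic_grid R n \<times> UNIV" for n by (auto simp: I_def)
  have finI: "finite (I n)" for n
    by (rule finite_subset[OF I_sub]) (auto simp: finite_dyadic_grid)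
  have A_ev: "A n t \<in> events" for n t
    unfolding A_def by (cases t) (simp, measurable)
  have bad_eq: "bad n = (\<Union>t\<in>I n. A n t)" for n
  proof (intro equalityI subsetI)
    fix \<omega> assume "\<omega> \<in> bad n"
    then obtain p q i where "(p, q, i) \<in> I n" "\<omega> \<in> A n (p, q, i)"
      unfolding bad_def I_def A_def by auto
    then show "\<omega> \<in> (\<Union>t\<in>I n. A n t)" by blast
  next
    fix \<omega> assume "\<omega> \<in> (\<Union>t\<in>I n. A n t)"
    then obtain p q i where "(p, q, i) \<in> I n" "\<omega> \<in> A n (p, q, i)" by auto
    then show "\<omega> \<in> bad n" unfolding bad_def I_def A_def by auto
  qed
  show "bad n \<in> events"
    unfolding bad_eq using finI A_ev by (intro sets.finite_UN) auto
  define x where "x = (1 / 2 :: real) powr (\<alpha> - \<gamma>)"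
  have x: "0 < x" "x < 1" using \<gamma> powr_less_mono2[of "\<alpha> - \<gamma>" "1 / 2" 1] by (auto simp: x_def)
  let ?d = "CARD('d)"
  obtain p where p: "x ^ p < (1 / 2) / (2 ^ ?d)\<^sup>2"
    using real_arch_pow_inv[of "(1 / 2) / (2 ^ ?d)\<^sup>2" x] x by auto
  have "x ^ (2 * p) \<le> x ^ p" using x by (intro power_decreasing) auto
  then have "(2 ^ ?d)\<^sup>2 * x ^ (2 * p) \<le> (2 ^ ?d)\<^sup>2 * x ^ p" by (intro mult_left_mono) auto
  also have "\<dots> \<le> 1 / 2" using p by (simp add: pos_less_divide_eq mult.commute)
  finally have p2: "(2 ^ ?d)\<^sup>2 * x ^ (2 * p) \<le> 1 / 2" .
  define D where "D = (3 * real ?d) powr \<alpha>"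
  define C0 where "C0 = fact (2 * p) * D ^ (2 * p)"
  have C0: "C0 \<ge> 0" by (simp add: C0_def D_def)
  define C where "C = ((2 * real_of_int R + 1) ^ ?d)\<^sup>2 * real CARD('m) * C0"
  have pA: "prob (A n t) \<le> C0 * (x ^ (2 * p)) ^ n" if t: "t \<in> I n" for n t
  proof -
    obtain u v i where t': "t = (u, v, i)" "u \<noteq> v" "\<And>i. \<bar>u $ i - v $ i\<bar> \<le> 3 * (1 / 2) ^ n"
      using t by (auto simp: I_def)
    let ?y = "((1 / 2) powr \<gamma>) ^ n"
    have "norm (u - v) \<le> (\<Sum>i\<in>UNIV. \<bar>(u - v) $ i\<bar>)" by (rule norm_le_l1_cart)
    also have "\<dots> \<le> (\<Sum>i\<in>(UNIV :: 'd set). 3 * (1 / 2) ^ n)" using t'(3) by (intro sum_mono) simp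
    also have "\<dots> = 3 * real ?d * (1 / 2) ^ n" by simp
    finally have "norm (u - v) powr \<alpha> \<le> (3 * real ?d * (1 / 2) ^ n) powr \<alpha>"
      using \<gamma> by (intro powr_mono2) auto
    also have "\<dots> = D * ((1 / 2) powr \<alpha>) ^ n"
      by (simp add: D_def powr_mult powr_realpow[symmetric] powr_powr mult.commute)
    finally have "norm (u - v) powr \<alpha> / ?y \<le> D * ((1 / 2) powr \<alpha>) ^ n / ?y"
      by (intro divide_right_mono) auto
    also have "\<dots> = D * x ^ n" by (simp add: x_def powr_diff power_divide)
    finally have le: "norm (u - v) powr \<alpha> / ?y \<le> D * x ^ n" .
    have "prob (A n t) \<le> fact (2 * p) * (norm (u - v) powr \<alpha> / ?y) ^ (2 * p)"
      unfolding A_def t' using component_tail[OF t'(2), of ?y i p] by simp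
    also have "\<dots> \<le> fact (2 * p) * (D * x ^ n) ^ (2 * p)"
      using le by (intro mult_left_mono power_mono) auto
    also have "\<dots> = C0 * (x ^ (2 * p)) ^ n"
      by (simp add: C0_def power_mult_distrib power_mult[symmetric] mult.commute)
    finally show ?thesis .
  qed
  have "prob (bad n) \<le> C * (1 / 2) ^ n" for n
  proof -
    have "prob (bad n) \<le> (\<Sum>t\<in>I n. prob (A n t))"
      unfolding bad_eq using finI A_ev by (intro finite_measure_subadditive_finite) auto
    also have "\<dots> \<le> real (card (I n)) * (C0 * (x ^ (2 * p)) ^ n)"
      using pA by (intro sum_bounded_above) auto
    also have "\<dots> \<le> (((2 * real_of_int R + 1) * 2 ^ n) ^ ?d)\<^sup>2 * real CARD('m) * (C0 * (x ^ (2 * p)) ^ n)"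
    proof (intro mult_right_mono)
      have "card (I n) \<le> card ((dyadic_grid R n :: (real ^ 'd) set) \<times> (dyadic_grid R n :: (real ^ 'd) set) \<times> (UNIV :: 'm set))"
        using I_sub by (intro card_mono) (auto simp: finite_dyadic_grid)
      then have "real (card (I n)) \<le> (real (card (dyadic_grid R n :: (real ^ 'd) set)))\<^sup>2 * real CARD('m)"
        by (simp add: card_cartesian_product power2_eq_square mult_ac flip: of_nat_mult)
      also have "\<dots> \<le> (((2 * real_of_int R + 1) * 2 ^ n) ^ ?d)\<^sup>2 * real CARD('m)"
        using card_dyadic_grid_le[OF R, where 'd = 'd] by (intro mult_right_mono power_mono) auto
      finally show "real (card (I n)) \<le> (((2 * real_of_int R + 1) * 2 ^ n) ^ ?d)\<^sup>2 * real CARD('m)" .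
    qed (use C0 x in auto)
    also have "\<dots> = C * ((2 ^ ?d)\<^sup>2 * x ^ (2 * p)) ^ n"
      by (simp add: C_def power_mult_distrib power_mult[symmetric] mult_ac)
    also have "\<dots> \<le> C * (1 / 2) ^ n"
      using p2 x C0 by (intro mult_left_mono power_mono) (auto simp: C_def)
    finally show ?thesis .
  qed
  then show "\<exists>C. \<forall>n. prob (bad n) \<le> C * (1 / 2) ^ n" by blast
qed

lemma AE_locally_Holder:
  fixes E :: "(real ^ 'd) set"
  assumes E: "bounded E" and \<gamma>: "0 < \<gamma>" "\<gamma> < \<alpha>"
  shows "AE \<omega> in M. \<exists>H r. 0 \<le> H \<and> 0 < r \<and>
    (\<forall>x\<in>E. \<forall>y\<in>E. dist x y \<le> r \<longrightarrow> norm (B \<omega> x - B \<omega> y) \<le> H * dist x y powr \<gamma>)"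
proof -
  obtain b where b: "\<And>x. x \<in> E \<Longrightarrow> norm x \<le> b" using E by (auto simp: bounded_iff)
  define R where "R = \<lceil>\<bar>b\<bar>\<rceil> + 1"
  have R: "0 \<le> R" by (simp add: R_def)
  have ER: "\<bar>x $ i\<bar> \<le> real_of_int R - 1" if "x \<in> E" for x i
    using component_le_norm_cart[of x i] b[OF that] by (simp add: R_def) linarith
  define bad where "bad n = {\<omega> \<in> space M. \<exists>p\<in>dyadic_grid R n. \<exists>q\<in>dyadic_grid R n. p \<noteq> q \<and>
      (\<forall>i. \<bar>p $ i - q $ i\<bar> \<le> 3 * (1 / 2) ^ n) \<and> (\<exists>i. ((1 / 2) powr \<gamma>) ^ n \<le> \<bar>B \<omega> p $ i - B \<omega> q $ i\<bar>)}" for n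
  have \<alpha>: "0 < \<alpha>" using \<gamma> by simp
  obtain C where C: "\<And>n. prob (bad n) \<le> C * (1 / 2) ^ n"
    using grid_oscillation_prob(2)[OF \<gamma>(2) \<alpha> R] unfolding bad_def by blast
  have ev: "bad n \<in> events" for n
    using grid_oscillation_prob(1)[OF \<gamma>(2) \<alpha> R] unfolding bad_def by blast
  have "summable (\<lambda>n. prob (bad n))"
  proof (rule summable_comparison_test')
    show "summable (\<lambda>n. C * (1 / 2) ^ n)" by (intro summable_mult summable_geometric) auto
  qed (use C in auto)
  then have "AE \<omega> in M. eventually (\<lambda>n. \<omega> \<in> space M - bad n) sequentially"
    using ev by (intro borel_cantelli_AE1) (auto simp: emeasure_eq_measure)
  then show ?thesis using AE_continuous
  proof eventually_elim
    case (elim \<omega>)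
    then obtain N where N: "\<And>n. N \<le> n \<Longrightarrow> \<omega> \<in> space M - bad n" by (auto simp: eventually_sequentially)
    let ?K = "real CARD('m)"
    have grid: "norm (B \<omega> p - B \<omega> q) \<le> ?K * ((1 / 2) powr \<gamma>) ^ n"
      if n: "N \<le> n" and pq: "p \<in> dyadic_grid R n" "q \<in> dyadic_grid R n"
        "\<And>i. \<bar>p $ i - q $ i\<bar> \<le> 3 * (1 / 2) ^ n" for n p q
    proof (cases "p = q")
      case False
      have "\<bar>B \<omega> p $ i - B \<omega> q $ i\<bar> < ((1 / 2) powr \<gamma>) ^ n" for i
        using N[OF n] pq False unfolding bad_def by (simp add: not_le) (metis not_le)
      then have "(\<Sum>i\<in>UNIV. \<bar>(B \<omega> p - B \<omega> q) $ i\<bar>) \<le> (\<Sum>i\<in>(UNIV :: 'm set). ((1 / 2) powr \<gamma>) ^ n)"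
        by (intro sum_mono) (auto intro: less_imp_le)
      then show ?thesis using norm_le_l1_cart[of "B \<omega> p - B \<omega> q"] by simp
    qed simp
    let ?H = "?K * (2 / (1 - (1 / 2) powr \<gamma>) + 1) * 2 powr \<gamma>"
    have "(1 / 2 :: real) powr \<gamma> < 1" using \<gamma> powr_less_mono2[of \<gamma> "1 / 2" 1] by simp
    then have H: "0 \<le> ?H" by simp
    have "norm (B \<omega> x - B \<omega> y) \<le> ?H * dist x y powr \<gamma>"
      if "x \<in> E" "y \<in> E" "dist x y \<le> (1 / 2) ^ N" for x y
      using that ER by (intro dyadic_chaining[OF elim(2) \<gamma>(1) _ grid]) auto
    with H show ?case by (intro exI[of _ ?H] exI[of _ "(1 / 2) ^ N"]) auto
  qed
qed

end

section \<open>Cell counts of the image at scales without good covers\<close>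

lemma dyadic_ratio_ex:
  fixes \<rho> \<delta> :: real
  assumes "0 < \<rho>" "\<rho> \<le> \<delta>"
  obtains J where "2 ^ J * \<rho> \<le> \<delta>" "1 / 2 ^ Suc J \<le> \<rho> / \<delta>"
proof -
  have \<delta>: "0 < \<delta>" using assms by simp
  obtain n where n: "comparable_scale 1 (\<rho> / \<delta>) n"
    using comparable_scale_ex_nat[of "\<rho> / \<delta>" 1] assms \<delta> by auto
  then have n': "(1 / 2) ^ n \<le> \<rho> / \<delta>" "\<rho> / \<delta> \<le> 2 * (1 / 2) ^ n"
    using assms \<delta> by (auto simp: comparable_scale_def)
  show ?thesis
  proof (cases n)
    case 0
    then have "\<rho> = \<delta>" using n'(1) assms \<delta> by simp
    then show ?thesis using that[of 0] \<delta> by simp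
  next
    case (Suc J)
    then show ?thesis using that[of J] n' \<delta> by (simp add: field_simps power_one_over)
  qed
qed

context fractional_Brownian_motion
begin

text \<open>
  The second moment argument. \<open>V\<close> is the mass of the pairs of weighted points whose images are close
  in every coordinate, in particular of those whose images lie in a common cell. Its expectation is
  the energy of the weights for the kernel of \<open>joint_small_ball\<close>, which
  \<open>Riesz_potential_bound\<close> estimates. The condition \<open>t' \<le> (1 - \<theta>) m\<close> makes the far pairs, with the factor
  \<open>(\<rho>/\<delta>) powr (\<alpha> m) = \<rho> powr (\<alpha> m (1 - \<theta>))\<close>, contribute no more than the near ones. Where \<open>V\<close> is not
  much larger than its expectation, \<open>Cauchy_Schwarz_label_count\<close> forces many cells.
\<close>

lemma cell_count_prob_at_scale:
  fixes E :: "(real ^ 'd) set"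
  assumes E: "bounded E" and \<alpha>: "0 < \<alpha>" and \<theta>: "0 < \<theta>" "\<theta> \<le> 1" and \<epsilon>: "0 < \<epsilon>"
    and t': "0 \<le> t'" "t' < real CARD('m)" "t' \<le> (1 - \<theta>) * real CARD('m)"
    and \<delta>: "0 < \<delta>" "\<delta> \<le> 1" and k: "comparable_scale (\<alpha> / \<theta>) \<delta> k"
    and no_cover: "\<not> (\<exists>C. admissible_cover \<theta> (\<alpha> * t') \<epsilon> \<delta> E C)"
  defines "a \<equiv> \<alpha> * real CARD('m)"
  defines "C \<equiv> (4 * real CARD('d)) powr a * (4 ^ CARD('d) / (1 - 2 powr (\<alpha> * t' - a)) / \<epsilon> + 1) * 2 powr t'"
  shows "\<exists>A\<in>events. prob A \<le> C * ((1 / 2) ^ k) powr (t' - t) \<and>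
    (\<forall>\<omega>\<in>space M - A. bounded (B \<omega> ` E) \<longrightarrow> (2 ^ k) powr t < real (card (cell ((1 / 2) ^ k) ` B \<omega> ` E)))"
proof -
  note [measurable] = component_measurable
  define h where "h = (1 / 2 :: real) ^ k"
  have h: "0 < h" by (simp add: h_def)
  define \<rho> where "\<rho> = \<delta> powr (1 / \<theta>)"
  have \<rho>: "0 < \<rho>" "\<rho> \<le> 1" using \<delta> \<theta> by (auto simp: \<rho>_def intro: powr_le1)
  have \<rho>\<alpha>: "\<rho> powr \<alpha> = \<delta> powr (\<alpha> / \<theta>)" by (simp add: \<rho>_def powr_powr)
  have h\<rho>: "h \<le> \<rho> powr \<alpha>" "\<rho> powr \<alpha> \<le> 2 * h"
    using k by (auto simp: comparable_scale_def h_def \<rho>\<alpha>)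
  have \<rho>\<theta>: "\<rho> powr \<theta> = \<delta>" using \<delta> \<theta> by (simp add: \<rho>_def powr_powr)
  have "\<rho> powr 1 \<le> \<rho> powr \<theta>" using \<rho> \<theta> by (intro powr_mono') auto
  then have "\<rho> \<le> \<delta>" using \<rho> \<rho>\<theta> by simp
  then obtain J where J: "2 ^ J * \<rho> \<le> \<delta>" "1 / 2 ^ Suc J \<le> \<rho> / \<delta>"
    using dyadic_ratio_ex[OF \<rho>(1)] by blast
  define s where "s = \<alpha> * t'"
  have s: "0 \<le> s" "s < a" using \<alpha> t' by (auto simp: s_def a_def)
  obtain P w where P: "finite P" "P \<subseteq> E" and w: "\<And>p. 0 \<le> w p" and W: "\<epsilon> < sum w P"
    and ball: "\<And>x j. j \<le> J \<Longrightarrow> sum w {q\<in>P. norm (x - q) \<le> \<rho> * 2 ^ j / (2 * real CARD('d))}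
        \<le> 4 ^ CARD('d) * (2 ^ j * \<rho>) powr s"
    using Frostman_weights[OF E \<delta>(1) \<rho>_def J(1) no_cover] unfolding s_def by blast
  define W where "W = sum w P"
  have W0: "\<epsilon> < W" "0 < W" using W \<epsilon> by (auto simp: W_def)
  define close where "close p q = {\<omega> \<in> space M. \<forall>i. \<bar>B \<omega> p $ i - B \<omega> q $ i\<bar> \<le> h}" for p q
  have close_ev[measurable]: "close p q \<in> events" for p q
    unfolding close_def by measurable
  define \<kappa> where "\<kappa> p q = prob (close p q)" for p q
  have \<kappa>: "\<kappa> p q \<le> (\<rho> / norm (p - q)) powr a" if "q \<noteq> p" for p q
  proof -
    have "\<kappa> p q \<le> (h / norm (p - q) powr \<alpha>) ^ CARD('m)"
      unfolding \<kappa>_def close_def using that h by (intro joint_small_ball) auto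
    also have "\<dots> \<le> (\<rho> powr \<alpha> / norm (p - q) powr \<alpha>) ^ CARD('m)"
      using h\<rho> h by (intro power_mono divide_right_mono) auto
    also have "\<dots> = ((\<rho> / norm (p - q)) powr \<alpha>) ^ CARD('m)"
      using \<rho> by (simp add: powr_divide)
    also have "\<dots> = (\<rho> / norm (p - q)) powr a"
      using \<rho> that by (simp add: powr_realpow[symmetric] powr_powr a_def)
    finally show ?thesis .
  qed
  define C1 where "C1 = 4 ^ CARD('d) / (1 - 2 powr (s - a))"
  have "2 powr (s - a) \<le> (1 :: real)" using s powr_mono[of "s - a" 0 2] by simp
  then have C1: "0 \<le> C1" by (simp add: C1_def)
  define C2 where "C2 = (4 * real CARD('d)) powr a"
  have C2: "0 \<le> C2" by (simp add: C2_def)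
  have pot: "(\<Sum>q\<in>P. w q * \<kappa> p q) \<le> C2 * (C1 * \<rho> powr s + (\<rho> / \<delta>) powr a * W)" for p
  proof -
    have "1 \<le> CARD('d)" by (simp add: Suc_le_eq)
    then have "1 \<le> 2 * real CARD('d)" by linarith
    then have "(\<Sum>q\<in>P. w q * \<kappa> p q) \<le> (2 * (2 * real CARD('d))) powr a *
        (4 ^ CARD('d) / (1 - 2 powr (s - a)) * \<rho> powr s + (1 / 2 ^ Suc J) powr a * sum w P)"
      using P w \<rho> s ball \<kappa> by (intro Riesz_potential_bound) (auto simp: \<kappa>_def)
    also have "\<dots> = C2 * (C1 * \<rho> powr s + (1 / 2 ^ Suc J) powr a * W)"
      by (simp add: C2_def C1_def W_def)
    also have "\<dots> \<le> C2 * (C1 * \<rho> powr s + (\<rho> / \<delta>) powr a * W)"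
      using J(2) s C2 W0 by (intro mult_left_mono add_left_mono mult_right_mono powr_mono2) auto
    finally show ?thesis .
  qed
  define V where "V \<omega> = (\<Sum>p\<in>P. \<Sum>q\<in>P. w p * w q * indicator (close p q) \<omega>)" for \<omega>
  have intV: "integrable M V"
    unfolding V_def by (intro Bochner_Integration.integrable_sum integrable_mult_right integrable_real_indicator)
      (auto simp: emeasure_eq_measure)
  have "expectation V = (\<Sum>p\<in>P. \<Sum>q\<in>P. w p * w q * \<kappa> p q)"
    unfolding V_def \<kappa>_def by (simp add: Bochner_Integration.integral_sum integrable_real_indicator emeasure_eq_measure)
  also have "\<dots> = (\<Sum>p\<in>P. w p * (\<Sum>q\<in>P. w q * \<kappa> p q))"
    by (simp add: sum_distrib_left mult_ac)
  also have "\<dots> \<le> (\<Sum>p\<in>P. w p * (C2 * (C1 * \<rho> powr s + (\<rho> / \<delta>) powr a * W)))"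
    using pot w by (intro sum_mono mult_left_mono) auto
  also have "\<dots> = W * (C2 * (C1 * \<rho> powr s + (\<rho> / \<delta>) powr a * W))"
    by (simp add: W_def sum_distrib_right)
  also have "\<dots> \<le> W * (C2 * (C1 * (\<rho> powr \<alpha>) powr t' * (W / \<epsilon>) + (\<rho> powr \<alpha>) powr t' * W))"
  proof (intro mult_left_mono add_mono mult_right_mono)
    have "C1 * \<rho> powr s = C1 * (\<rho> powr \<alpha>) powr t' * 1" by (simp add: s_def powr_powr)
    also have "\<dots> \<le> C1 * (\<rho> powr \<alpha>) powr t' * (W / \<epsilon>)"
      using W0 \<epsilon> C1 by (intro mult_left_mono) auto
    finally show "C1 * \<rho> powr s \<le> C1 * (\<rho> powr \<alpha>) powr t' * (W / \<epsilon>)" .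
    have "\<rho> / \<delta> = \<rho> powr (1 - \<theta>)" using \<rho> \<rho>\<theta> by (simp add: powr_diff)
    then have "(\<rho> / \<delta>) powr a = (\<rho> powr \<alpha>) powr ((1 - \<theta>) * real CARD('m))"
      by (simp add: powr_powr a_def mult_ac)
    also have "\<dots> \<le> (\<rho> powr \<alpha>) powr t'"
      using \<rho> \<alpha> t' by (intro powr_mono') (auto intro: powr_le1)
    finally show "(\<rho> / \<delta>) powr a \<le> (\<rho> powr \<alpha>) powr t'" .
  qed (use W0 C2 in auto)
  also have "\<dots> = W\<^sup>2 * (C2 * (C1 / \<epsilon> + 1) * (\<rho> powr \<alpha>) powr t')"
    by (simp add: power2_eq_square algebra_simps)
  also have "\<dots> \<le> W\<^sup>2 * (C2 * (C1 / \<epsilon> + 1) * (2 * h) powr t')"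
    using h\<rho> t' C1 C2 \<epsilon> by (intro mult_left_mono powr_mono2) auto
  also have "\<dots> = W\<^sup>2 * (C * h powr t')"
    using h by (simp add: powr_mult C_def C1_def C2_def s_def)
  finally have EV: "expectation V \<le> W\<^sup>2 * (C * h powr t')" .
  have V0: "0 \<le> V \<omega>" for \<omega> unfolding V_def using w by (intro sum_nonneg) auto
  define A where "A = {\<omega> \<in> space M. W\<^sup>2 * h powr t \<le> V \<omega>}"
  have Aev: "A \<in> events" unfolding A_def using intV by measurable
  have "prob A \<le> expectation V / (W\<^sup>2 * h powr t)"
    unfolding A_def using W0 h V0 by (intro integral_Markov_inequality_measure[OF intV, of "{}"]) auto
  also have "\<dots> \<le> W\<^sup>2 * (C * h powr t') / (W\<^sup>2 * h powr t)"
    using EV by (intro divide_right_mono) auto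
  also have "\<dots> = C * h powr (t' - t)"
    using W0 h by (simp add: powr_diff)
  finally have pA: "prob A \<le> C * h powr (t' - t)" .
  have "(2 ^ k) powr t < real (card (cell h ` B \<omega> ` E))"
    if \<omega>: "\<omega> \<in> space M" "\<omega> \<notin> A" and bd: "bounded (B \<omega> ` E)" for \<omega>
  proof -
    let ?l = "\<lambda>p. cell h (B \<omega> p)"
    let ?N = "real (card (cell h ` B \<omega> ` E))"
    have "(\<Sum>p\<in>P. \<Sum>q\<in>P. if ?l p = ?l q then w p * w q else 0) \<le> V \<omega>"
      unfolding V_def
    proof (intro sum_mono)
      fix p q
      show "(if ?l p = ?l q then w p * w q else 0) \<le> w p * w q * indicator (close p q) \<omega>"
      proof (cases "?l p = ?l q")
        case True
        then have "\<omega> \<in> close p q"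
          using cell_eq_component_dist[OF h True] \<omega> by (auto simp: close_def intro: less_imp_le)
        with True show ?thesis by simp
      qed (use w in auto)
    qed
    moreover have "real (card (?l ` P)) \<le> ?N"
      using finite_cells[OF h bd] P(2) by (auto intro!: card_mono simp: image_image)
    ultimately have le: "W\<^sup>2 \<le> ?N * V \<omega>"
      using Cauchy_Schwarz_label_count[OF P(1), of w ?l] w
      unfolding W_def by (smt (verit) mult_mono of_nat_0_le_iff sum_nonneg mult_nonneg_nonneg)
    have "?N \<noteq> 0"
    proof
      assume "?N = 0"
      then show False using le W0 by simp
    qed
    then have N: "0 < ?N" by simp
    note le
    also have "?N * V \<omega> < ?N * (W\<^sup>2 * h powr t)"
      using \<omega> N by (intro mult_strict_left_mono) (auto simp: A_def)
    finally have "W\<^sup>2 * 1 < W\<^sup>2 * (?N * h powr t)" by (simp add: mult_ac)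
    then have "1 < ?N * h powr t" using W0 by (simp only: mult_less_cancel_left_pos zero_less_power)
    moreover have "h powr t = 1 / (2 ^ k) powr t" by (simp add: h_def power_one_over powr_divide)
    ultimately show ?thesis by (simp add: field_simps)
  qed
  then show ?thesis using Aev pA by (intro bexI[of _ A]) (auto simp: h_def)
qed

text \<open>
  Borel-Cantelli over the mesh levels. The exceptional sets are chosen for levels, not for scales,
  since the conclusion only mentions the level and there are uncountably many scales.
\<close>

lemma AE_cell_count_at_uncovered_scales:
  fixes E :: "(real ^ 'd) set"
  assumes E: "bounded E" and \<alpha>: "0 < \<alpha>" and \<theta>: "0 < \<theta>" "\<theta> \<le> 1" and \<epsilon>: "0 < \<epsilon>"
    and t': "0 \<le> t'" "t < t'" "t' < real CARD('m)" "t' \<le> (1 - \<theta>) * real CARD('m)"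
  shows "AE \<omega> in M. eventually (\<lambda>k. \<forall>\<delta>. 0 < \<delta> \<and> \<delta> \<le> 1 \<and> comparable_scale (\<alpha> / \<theta>) \<delta> k \<and>
      \<not> (\<exists>C. admissible_cover \<theta> (\<alpha> * t') \<epsilon> \<delta> E C) \<and> bounded (B \<omega> ` E) \<longrightarrow>
      (2 ^ k) powr t < real (card (cell ((1 / 2) ^ k) ` B \<omega> ` E))) sequentially"
proof -
  define good where "good \<delta> k \<longleftrightarrow> 0 < \<delta> \<and> \<delta> \<le> 1 \<and> comparable_scale (\<alpha> / \<theta>) \<delta> k \<and>
      \<not> (\<exists>C. admissible_cover \<theta> (\<alpha> * t') \<epsilon> \<delta> E C)" for \<delta> k
  define many where "many k \<omega> \<longleftrightarrow> (bounded (B \<omega> ` E) \<longrightarrow>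
      (2 ^ k) powr t < real (card (cell ((1 / 2) ^ k) ` B \<omega> ` E)))" for k \<omega>
  define C where "C = (4 * real CARD('d)) powr (\<alpha> * real CARD('m)) *
      (4 ^ CARD('d) / (1 - 2 powr (\<alpha> * t' - \<alpha> * real CARD('m))) / \<epsilon> + 1) * 2 powr t'"
  have "\<alpha> * t' \<le> \<alpha> * real CARD('m)" using \<alpha> t' by simp
  then have "2 powr (\<alpha> * t' - \<alpha> * real CARD('m)) \<le> (1 :: real)"
    using powr_mono[of "\<alpha> * t' - \<alpha> * real CARD('m)" 0 2] by simp
  then have C: "0 \<le> C"
    unfolding C_def using \<epsilon> by (intro mult_nonneg_nonneg add_nonneg_nonneg divide_nonneg_nonneg) auto
  have "\<exists>A\<in>events. prob A \<le> C * ((1 / 2) ^ k) powr (t' - t) \<and> (\<forall>\<delta>. good \<delta> k \<longrightarrow> (\<forall>\<omega>\<in>space M - A. many k \<omega>))" for k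
  proof (cases "\<exists>\<delta>. good \<delta> k")
    case True
    then obtain \<delta> where "good \<delta> k" by blast
    then show ?thesis
      using cell_count_prob_at_scale[OF E \<alpha> \<theta> \<epsilon> t'(1,3,4), of \<delta> k t]
      unfolding good_def many_def C_def by blast
  next
    case False
    then show ?thesis using C by (intro bexI[of _ "{}"]) auto
  qed
  then obtain A where A: "\<And>k. A k \<in> events" "\<And>k. prob (A k) \<le> C * ((1 / 2) ^ k) powr (t' - t)"
    "\<And>k \<delta> \<omega>. good \<delta> k \<Longrightarrow> \<omega> \<in> space M - A k \<Longrightarrow> many k \<omega>" by metis
  have "summable (\<lambda>k. prob (A k))"
  proof (rule summable_comparison_test')
    have "(1 / 2 :: real) powr (t' - t) < 1" using t' powr_less_mono2[of "t' - t" "1 / 2" 1] by simp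
    then show "summable (\<lambda>k. C * ((1 / 2) powr (t' - t)) ^ k)"
      by (intro summable_mult summable_geometric) auto
    have "((1 / 2) ^ k) powr (t' - t) = ((1 / 2 :: real) powr (t' - t)) ^ k" for k
      by (simp add: powr_realpow[symmetric] powr_powr mult.commute)
    then show "norm (prob (A k)) \<le> C * ((1 / 2) powr (t' - t)) ^ k" if "k \<ge> 0" for k
      using A(2)[of k] by simp
  qed
  then have "AE \<omega> in M. eventually (\<lambda>k. \<omega> \<in> space M - A k) sequentially"
    using A(1) by (intro borel_cantelli_AE1) (auto simp: emeasure_eq_measure)
  then show ?thesis
  proof eventually_elim
    case (elim \<omega>)
    then show ?case
      by eventually_elim (use A(3) in \<open>auto simp: good_def many_def\<close>)
  qed
qed

end

section \<open>Images of full dimension\<close>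

context scale_quantifier
begin

lemma fBm_image_full_dimension_if:
  fixes B :: "'w \<Rightarrow> real ^ 'd \<Rightarrow> real ^ 'm" and E :: "(real ^ 'd) set"
  assumes fBm: "fractional_Brownian_motion M \<alpha> B"
    and E: "compact E" and \<alpha>: "0 < \<alpha>" and \<theta>: "0 < \<theta>" "\<theta> \<le> 1"
    and dimE: "\<And>\<theta>'. 0 < \<theta>' \<Longrightarrow> \<theta>' \<le> 1 \<Longrightarrow> \<alpha> * real CARD('m) \<le> intermediate_dim \<theta>' E"
  shows "AE \<omega> in M. intermediate_dim \<theta> (B \<omega> ` E) = real CARD('m)"
proof -
  interpret fractional_Brownian_motion M \<alpha> B by (rule fBm)
  let ?m = "real CARD('m)"
  have bE: "bounded E" using E by (rule compact_imp_bounded)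
  have not_few: "AE \<omega> in M. bounded (B \<omega> ` E) \<longrightarrow>
      \<not> QN (\<lambda>k. real (card (cell ((1 / 2) ^ k) ` B \<omega> ` E)) \<le> (2 ^ k) powr (?m - 1 / real (Suc j)))" for j
  proof -
    define t where "t = ?m - 1 / real (Suc j)"
    have "1 / real (Suc j) \<le> 1" by simp
    moreover have "1 \<le> ?m" by (simp add: Suc_le_eq)
    ultimately have t: "0 \<le> t" "t < ?m" unfolding t_def by (linarith, simp)
    define t' where "t' = (t + ?m) / 2"
    have t': "0 \<le> t'" "t < t'" "t' < ?m" using t by (auto simp: t'_def)
    \<comment> \<open>The value of \<open>\<theta>\<close> for \<open>E\<close>; it makes \<open>(1 - \<eta>) m\<close> equal to \<open>t'\<close>.\<close>
    define \<eta> where "\<eta> = (?m - t') / ?m"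
    have \<eta>: "0 < \<eta>" "\<eta> \<le> 1" "t' \<le> (1 - \<eta>) * ?m" using t' by (auto simp: \<eta>_def field_simps)
    have "\<alpha> * t' < intermediate_dim \<eta> E"
      using dimE[OF \<eta>(1,2)] mult_strict_left_mono[OF t'(3) \<alpha>] by linarith
    then have "\<alpha> * t' \<notin> dim_exponents \<eta> E" using intermediate_dim_le by fastforce
    then obtain \<epsilon> where \<epsilon>: "0 < \<epsilon>" "\<not> Q (\<lambda>\<delta>. \<exists>C. admissible_cover \<eta> (\<alpha> * t') \<epsilon> \<delta> E C)"
      using \<alpha> t' by (auto simp: dim_exponents_def)
    have ev1: "eventually (\<lambda>x. x \<in> {0<..<1}) (at_right (0::real))"
      by (rule eventually_at_right_real) simp
    show ?thesis
      using AE_cell_count_at_uncovered_scales[OF bE \<alpha> \<eta>(1,2) \<epsilon>(1) t' \<eta>(3)]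
    proof eventually_elim
      case (elim \<omega>)
      show ?case
      proof (intro impI notI)
        assume bd: "bounded (B \<omega> ` E)"
          and "QN (\<lambda>k. real (card (cell ((1 / 2) ^ k) ` B \<omega> ` E)) \<le> (2 ^ k) powr (?m - 1 / real (Suc j)))"
        then have "QN (\<lambda>k. real (card (cell ((1 / 2) ^ k) ` B \<omega> ` E)) \<le> (2 ^ k) powr t)"
          by (simp add: t_def)
        moreover have "eventually (\<lambda>k. real (card (cell ((1 / 2) ^ k) ` B \<omega> ` E)) \<le> (2 ^ k) powr t \<longrightarrow>
            (\<forall>\<delta>. 0 < \<delta> \<longrightarrow> \<delta> \<le> 1 \<longrightarrow> comparable_scale (\<alpha> / \<eta>) \<delta> k \<longrightarrow>
              (\<exists>C. admissible_cover \<eta> (\<alpha> * t') \<epsilon> \<delta> E C))) sequentially"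
          using elim by eventually_elim (use bd in \<open>auto simp: not_less[symmetric]\<close>)
        ultimately have "QN (\<lambda>k. \<forall>\<delta>. 0 < \<delta> \<longrightarrow> \<delta> \<le> 1 \<longrightarrow> comparable_scale (\<alpha> / \<eta>) \<delta> k \<longrightarrow>
              (\<exists>C. admissible_cover \<eta> (\<alpha> * t') \<epsilon> \<delta> E C))" by (rule QN_mp)
        then have "Q (\<lambda>\<delta>. \<delta> \<le> 1 \<longrightarrow> (\<exists>C. admissible_cover \<eta> (\<alpha> * t') \<epsilon> \<delta> E C))"
          by (rule QN_imp_Q[of "\<alpha> / \<eta>", rotated]) (use \<alpha> \<eta> in auto)
        then have "Q (\<lambda>\<delta>. \<exists>C. admissible_cover \<eta> (\<alpha> * t') \<epsilon> \<delta> E C)"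
          by (rule Q_mp) (use ev1 in eventually_elim, auto)
        with \<epsilon>(2) show False ..
      qed
    qed
  qed
  have "AE \<omega> in M. \<forall>j. bounded (B \<omega> ` E) \<longrightarrow>
      \<not> QN (\<lambda>k. real (card (cell ((1 / 2) ^ k) ` B \<omega> ` E)) \<le> (2 ^ k) powr (?m - 1 / real (Suc j)))"
    using not_few by (intro AE_all_countable[THEN iffD2] allI)
  then show ?thesis using AE_continuous
  proof eventually_elim
    case (elim \<omega>)
    have "bounded (B \<omega> ` E)"
      using elim(2) E by (meson compact_imp_bounded compact_continuous_image continuous_on_subset top_greatest)
    then show ?case using elim(1) \<theta> by (intro intermediate_dim_eq_dimension) auto
  qed
qed

lemma fBm_image_full_dimension_only_if:
  fixes B :: "'w \<Rightarrow> real ^ 'd \<Rightarrow> real ^ 'm" and E :: "(real ^ 'd) set"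
  assumes fBm: "fractional_Brownian_motion M \<alpha> B"
    and E: "compact E" and \<alpha>: "0 < \<alpha>" and \<theta>: "0 < \<theta>" "\<theta> \<le> 1" and \<theta>': "0 < \<theta>'" "\<theta>' \<le> 1"
    and full: "AE \<omega> in M. intermediate_dim \<theta> (B \<omega> ` E) = real CARD('m)"
  shows "\<alpha> * real CARD('m) \<le> intermediate_dim \<theta>' E"
proof (rule ccontr)
  interpret fractional_Brownian_motion M \<alpha> B by (rule fBm)
  let ?m = "real CARD('m)"
  have bE: "bounded E" using E by (rule compact_imp_bounded)
  assume "\<not> \<alpha> * ?m \<le> intermediate_dim \<theta>' E"
  then obtain s where s: "s \<in> dim_exponents \<theta>' E" "s < \<alpha> * ?m"
    using exponent_below_of_dim_less[OF bE \<theta>'] by (metis not_less)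
  have s0: "0 \<le> s" using s by (simp add: dim_exponents_def)
  \<comment> \<open>All that matters is that \<open>\<gamma>\<close> lies strictly between \<open>s/m\<close> and \<open>\<alpha>\<close>.\<close>
  define \<gamma> where "\<gamma> = (s / ?m + \<alpha>) / 2"
  have sm: "s / ?m < \<alpha>" "0 \<le> s / ?m" using s s0 by (auto simp: field_simps)
  have \<gamma>: "0 < \<gamma>" "\<gamma> < \<alpha>" "s / ?m < \<gamma>" using sm \<alpha> unfolding \<gamma>_def by argo+
  then have s\<gamma>: "s < \<gamma> * ?m" by (simp add: field_simps)
  have "AE \<omega> in M. False"
    using full AE_continuous AE_locally_Holder[OF bE \<gamma>(1,2)]
  proof eventually_elim
    case (elim \<omega>)
    then obtain H r where Hr: "0 \<le> H" "0 < r"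
      "\<And>x y. x \<in> E \<Longrightarrow> y \<in> E \<Longrightarrow> dist x y \<le> r \<Longrightarrow> norm (B \<omega> x - B \<omega> y) \<le> H * dist x y powr \<gamma>" by blast
    have "bounded (B \<omega> ` E)"
      using elim(2) E by (meson compact_imp_bounded compact_continuous_image continuous_on_subset top_greatest)
    from intermediate_dim_Holder_image_less[OF \<gamma>(1) Hr(1,2) \<theta>' \<theta> Hr(3) s(1) s\<gamma> this] elim(1)
    show False by simp
  qed
  then show False by simp
qed

theorem fBm_image_full_dimension_iff:
  fixes B :: "'w \<Rightarrow> real ^ 'd \<Rightarrow> real ^ 'm" and E :: "(real ^ 'd) set"
  assumes fBm: "fractional_Brownian_motion M \<alpha> B"
    and E: "compact E" and \<alpha>: "0 < \<alpha>" and \<theta>: "0 < \<theta>" "\<theta> \<le> 1"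
  shows "(AE \<omega> in M. intermediate_dim \<theta> (B \<omega> ` E) = real CARD('m)) \<longleftrightarrow>
    \<alpha> * real CARD('m) \<le> Lim (at_right 0) (\<lambda>\<theta>. intermediate_dim \<theta> E)"
proof -
  have bE: "bounded E" using E by (rule compact_imp_bounded)
  have "\<alpha> * real CARD('m) \<le> Lim (at_right 0) (\<lambda>\<theta>. intermediate_dim \<theta> E) \<longleftrightarrow>
      (\<forall>\<theta>'. 0 < \<theta>' \<and> \<theta>' \<le> 1 \<longrightarrow> \<alpha> * real CARD('m) \<le> intermediate_dim \<theta>' E)"
    by (intro le_Lim_at_right_iff intermediate_dim_mono_theta intermediate_dim_nonneg bE)
  then show ?thesis
    using fBm_image_full_dimension_if[OF fBm E \<alpha> \<theta>] fBm_image_full_dimension_only_if[OF fBm E \<alpha> \<theta>] by blast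
qed

end

theorem corollary3p5:
  fixes M :: "'w measure"
    and B :: "'w \<Rightarrow> real ^ 'd \<Rightarrow> real ^ 'm"
    and E :: "(real ^ 'd) set"
    and \<theta> \<alpha> :: real
  assumes "E \<noteq> {}" and "compact E"
    and "0 < \<theta>" and "\<theta> \<le> 1"
    and "CARD('m) \<le> CARD('d)"
    and "0 < \<alpha>" and "\<alpha> < 1"
    and "fractional_Brownian_motion M \<alpha> B"
  shows "((AE \<omega> in M. lower_intermediate_dim \<theta> (B \<omega> ` E) = real CARD('m))
            \<longleftrightarrow> \<alpha> * real CARD('m) \<le> lower_quasi_Hausdorff_dim E)
       \<and> ((AE \<omega> in M. upper_intermediate_dim \<theta> (B \<omega> ` E) = real CARD('m))
            \<longleftrightarrow> \<alpha> * real CARD('m) \<le> upper_quasi_Hausdorff_dim E)"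
  using lower.fBm_image_full_dimension_iff[OF assms(8,2,6,3,4)]
    upper.fBm_image_full_dimension_iff[OF assms(8,2,6,3,4)]
  unfolding lower_quasi_Hausdorff_dim_def upper_quasi_Hausdorff_dim_def
    lower_intermediate_dim_eq upper_intermediate_dim_eq
  by blast

end
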